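(* Let $p$ be a prime and let $\mathcal H$ be a $p$-rigid bipartite graph with fixed bipartition $(L_{\mathcal H},R_{\mathcal H})$ that is not complete bipartite, regarded as a two-sorted structure. Suppose that $\mathcal H$ has an induced subgraph that is a non-degenerate thick Z-graph with parts $A,B,C,D$ and parameters $\alpha_1,\alpha_2,\beta_1,\beta_2$. Then $\#_p\mathsf{BIS}(\alpha_1\alpha_2^{-1},\beta_1\beta_2^{-1})$ (multiplication and inversion modulo $p$) is polynomial-time reducible to $\#_p\mathsf{CSP}(\mathcal H)$.
   Context: Two-sorted convention: every bipartite graph $\mathcal G$ comes with a fixed bipartition $(L_{\mathcal G},R_{\mathcal G})$, and a homomorphism $\mathcal G\to\mathcal H$ is an edge-preserving map sending $L_{\mathcal G}$ into $L_{\mathcal H}$ and $R_{\mathcal G}$ into $R_{\mathcal H}$. $\#_p\mathsf{CSP}(\mathcal H)$: given such $\mathcal G$, compute the number of homomorphisms $\mathcal G\to\mathcal H$ modulo $p$. $\mathcal H$ is $p$-rigid if it has no automorphism (sort-preserving) of order $p$. For a graph $\mathcal K$ with distinguished vertex $x$ and $S\subseteq V(\mathcal H)$, $\mathsf{hom}((\mathcal K,x),(\mathcal H,S))=\sum_{v\in S}\mathsf{hom}((\mathcal K,x),(\mathcal H,v))$, where $\mathsf{hom}((\mathcal K,x),(\mathcal H,v))$ counts homomorphisms mapping $x$ to $v$. A bipartite graph is a thick Z-graph if its vertices are partitioned into $A,B,C,D$ with $A,C$ in the left part, $B,D$ in the right part, such that $A\cup B$, $C\cup B$, $C\cup D$ induce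 complete bipartite graphs and there are no edges between $A$ and $D$. An induced thick Z-subgraph of $\mathcal H$ with parts $A,B,C,D$ is non-degenerate with parameters $\alpha_1,\alpha_2,\beta_1,\beta_2$ if there exist graphs with distinguished vertices $(\mathcal K_L,x),(\mathcal K_R,x)$ such that $\mathsf{hom}((\mathcal K_L,x),(\mathcal H,A))\equiv\alpha_1\not\equiv0$, $\mathsf{hom}((\mathcal K_L,x),(\mathcal H,C))\equiv\alpha_2\not\equiv0$, $\mathsf{hom}((\mathcal K_R,x),(\mathcal H,D))\equiv\beta_1\not\equiv0$, $\mathsf{hom}((\mathcal K_R,x),(\mathcal H,B))\equiv\beta_2\not\equiv0$, and $\mathsf{hom}((\mathcal K_L,x),(\mathcal H,v))\equiv0$ for $v\in L_{\mathcal H}\setminus(A\cup C)$, $\mathsf{hom}((\mathcal K_R,x),(\mathcal H,v))\equiv0$ for $v\in R_{\mathcal H}\setminus(B\cup D)$, all modulo $p$. For $\alpha,\beta\not\equiv0\pmod p$, $\#_p\mathsf{BIS}(\alpha,\beta)$ is the problem: given a bipartite graph $\mathcal G$ with parts $L_{\mathcal G},R_{\mathcal G}$, compute $\sum_{I}\alpha^{|I\cap L_{\mathcal G}|}\beta^{|I\cap R_{\mathcal G}|}\bmod p$, the sum over all independent sets $I$ of $\mathcal G$. *)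

theory Defs
  imports
    "HOL-Library.FuncSet"
    "HOL-Combinatorics.Permutations"
    "HOL-Computational_Algebra.Polynomial"
    "HOL-Computational_Algebra.Primes"
    "HOL-Number_Theory.Cong"
    "HOL-Number_Theory.Modular_Inverse"
begin

section \<open>Bipartite graphs as two-sorted structures\<close>

text \<open>The edge joining the left vertex \<open>u\<close> and the right vertex \<open>v\<close> is stored as the
  pair \<open>(u, v)\<close>.\<close>

record 'v bigraph =
  lpart :: "'v set"
  rpart :: "'v set"
  edges :: "('v \<times> 'v) set"

definition bigraph :: "'v bigraph \<Rightarrow> bool" where
  "bigraph G \<longleftrightarrow> finite (lpart G) \<and> finite (rpart G) \<and> lpart G \<inter> rpart G = {} \<and>
     edges G \<subseteq> lpart G \<times> rpart G"

definition verts :: "'v bigraph \<Rightarrow> 'v set" where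
  "verts G = lpart G \<union> rpart G"

definition complete_bipartite :: "'v bigraph \<Rightarrow> bool" where
  "complete_bipartite G \<longleftrightarrow> edges G = lpart G \<times> rpart G"

definition induced_subgraph :: "'v bigraph \<Rightarrow> 'v set \<Rightarrow> 'v bigraph" where
  "induced_subgraph G W =
     \<lparr>lpart = lpart G \<inter> W, rpart = rpart G \<inter> W, edges = edges G \<inter> (W \<times> W)\<rparr>"

definition homs :: "'v bigraph \<Rightarrow> 'w bigraph \<Rightarrow> ('v \<Rightarrow> 'w) set" where
  "homs G H = {f \<in> verts G \<rightarrow>\<^sub>E verts H.
     f ` lpart G \<subseteq> lpart H \<and> f ` rpart G \<subseteq> rpart H \<and>
     (\<forall>(u, v) \<in> edges G. (f u, f v) \<in> edges H)}"

definition automorphism :: "'v bigraph \<Rightarrow> ('v \<Rightarrow> 'v) \<Rightarrow> bool" where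
  "automorphism H \<pi> \<longleftrightarrow> \<pi> permutes verts H \<and> \<pi> ` lpart H = lpart H \<and> \<pi> ` rpart H = rpart H \<and>
     (\<forall>u \<in> lpart H. \<forall>v \<in> rpart H. (\<pi> u, \<pi> v) \<in> edges H \<longleftrightarrow> (u, v) \<in> edges H)"

definition has_order :: "('v \<Rightarrow> 'v) \<Rightarrow> nat \<Rightarrow> bool" where
  "has_order \<pi> n \<longleftrightarrow> 0 < n \<and> \<pi> ^^ n = id \<and> (\<forall>k. 0 < k \<and> k < n \<longrightarrow> \<pi> ^^ k \<noteq> id)"

definition rigid :: "nat \<Rightarrow> 'v bigraph \<Rightarrow> bool" where
  "rigid p H \<longleftrightarrow> \<not> (\<exists>\<pi>. automorphism H \<pi> \<and> has_order \<pi> p)"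

definition hom_at :: "'v bigraph \<Rightarrow> 'v \<Rightarrow> 'w bigraph \<Rightarrow> 'w \<Rightarrow> nat" where
  "hom_at K x H v = card {f \<in> homs K H. f x = v}"

definition hom_set :: "'v bigraph \<Rightarrow> 'v \<Rightarrow> 'w bigraph \<Rightarrow> 'w set \<Rightarrow> nat" where
  "hom_set K x H S = (\<Sum>v\<in>S. hom_at K x H v)"


section \<open>Thick Z-graphs\<close>

definition thick_Z_graph ::
    "'v bigraph \<Rightarrow> 'v set \<Rightarrow> 'v set \<Rightarrow> 'v set \<Rightarrow> 'v set \<Rightarrow> bool" where
  "thick_Z_graph Z A B C D \<longleftrightarrow>
     lpart Z = A \<union> C \<and> rpart Z = B \<union> D \<and> A \<inter> C = {} \<and> B \<inter> D = {} \<and>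
     A \<times> B \<subseteq> edges Z \<and> C \<times> B \<subseteq> edges Z \<and> C \<times> D \<subseteq> edges Z \<and> A \<times> D \<inter> edges Z = {}"

definition induced_thick_Z ::
    "'v bigraph \<Rightarrow> 'v set \<Rightarrow> 'v set \<Rightarrow> 'v set \<Rightarrow> 'v set \<Rightarrow> bool" where
  "induced_thick_Z H A B C D \<longleftrightarrow> A \<union> B \<union> C \<union> D \<subseteq> verts H \<and>
     thick_Z_graph (induced_subgraph H (A \<union> B \<union> C \<union> D)) A B C D"

text \<open>Every finite graph is isomorphic to one with vertices of type \<^typ>\<open>nat\<close>, so the
  existential quantifiers range over all finite graphs with a distinguished vertex.\<close>

definition nondegenerate ::
    "nat \<Rightarrow> 'v bigraph \<Rightarrow> 'v set \<Rightarrow> 'v set \<Rightarrow> 'v set \<Rightarrow> 'v set \<Rightarrow> int \<Rightarrow> int \<Rightarrow> int \<Rightarrow> int \<Rightarrow> bool" where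
  "nondegenerate p H A B C D \<alpha>1 \<alpha>2 \<beta>1 \<beta>2 \<longleftrightarrow>
     (\<exists>(KL :: nat bigraph) x (KR :: nat bigraph) y.
        bigraph KL \<and> x \<in> verts KL \<and> bigraph KR \<and> y \<in> verts KR \<and>
        [int (hom_set KL x H A) = \<alpha>1] (mod int p) \<and> \<not> [\<alpha>1 = 0] (mod int p) \<and>
        [int (hom_set KL x H C) = \<alpha>2] (mod int p) \<and> \<not> [\<alpha>2 = 0] (mod int p) \<and>
        [int (hom_set KR y H D) = \<beta>1] (mod int p) \<and> \<not> [\<beta>1 = 0] (mod int p) \<and>
        [int (hom_set KR y H B) = \<beta>2] (mod int p) \<and> \<not> [\<beta>2 = 0] (mod int p) \<and>
        (\<forall>v \<in> lpart H - (A \<union> C). [hom_at KL x H v = 0] (mod p)) \<and>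
        (\<forall>v \<in> rpart H - (B \<union> D). [hom_at KR y H v = 0] (mod p)))"


section \<open>Polynomial-time Turing reductions\<close>

text \<open>Deterministic multitape oracle Turing machines over the tape alphabet consisting of the two
  bits and the blank \<^const>\<open>None\<close>. A tape \<open>(l, r)\<close> is two-way infinite: \<open>r\<close> lists the cells
  from the head to the right, \<open>l\<close> those left of the head, nearest first, and all other
  cells are blank.\<close>

datatype move = MoveLeft | Stay | MoveRight

type_synonym tape = "bool option list \<times> bool option list"

type_synonym config = "nat \<times> tape list"

fun head_symbol :: "tape \<Rightarrow> bool option" where
  "head_symbol (l, []) = None"
| "head_symbol (l, s # r) = s"

fun act :: "bool option \<times> move \<Rightarrow> tape \<Rightarrow> tape" where
  "act (s, Stay) (l, r) = (l, s # tl r)"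
| "act (s, MoveRight) (l, r) = (s # l, tl r)"
| "act (s, MoveLeft) ([], r) = ([], None # s # tl r)"
| "act (s, MoveLeft) (x # l, r) = (l, x # s # tl r)"

text \<open>The word on a tape extends from the head up to the first blank.\<close>

fun tape_word :: "tape \<Rightarrow> bool list" where
  "tape_word (l, r) = map the (takeWhile (\<lambda>s. s \<noteq> None) r)"

record oracle_tm =
  num_tapes :: nat
  num_states :: nat
  start_state :: nat
  halt_state :: nat
  query_state :: nat
  answer_state :: nat
  trans :: "nat \<Rightarrow> bool option list \<Rightarrow> nat \<times> (bool option \<times> move) list"

definition wf_oracle_tm :: "oracle_tm \<Rightarrow> bool" where
  "wf_oracle_tm M \<longleftrightarrow> 2 \<le> num_tapes M \<and>
     start_state M < num_states M \<and> halt_state M < num_states M \<and>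
     query_state M < num_states M \<and> answer_state M < num_states M \<and>
     (\<forall>q ss. q < num_states M \<and> length ss = num_tapes M \<longrightarrow>
        fst (trans M q ss) < num_states M \<and> length (snd (trans M q ss)) = num_tapes M)"

text \<open>Tape 0 holds the input and, on halting, the output. Tape 1 is the oracle tape: in the
  query state, one step replaces the word on it by the answer of the oracle. The halting state
  is a fixed point of the step function.\<close>

fun step :: "oracle_tm \<Rightarrow> (bool list \<Rightarrow> bool list) \<Rightarrow> config \<Rightarrow> config" where
  "step M orc (q, ts) =
     (if q = halt_state M then (q, ts)
      else if q = query_state M
        then (answer_state M, ts[1 := ([], map Some (orc (tape_word (ts ! 1))))])
      else let (q', as) = trans M q (map head_symbol ts) in (q', map2 act as ts))"

definition init_config :: "oracle_tm \<Rightarrow> bool list \<Rightarrow> config" where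
  "init_config M w = (start_state M, ([], map Some w) # replicate (num_tapes M - 1) ([], []))"

definition outputs_in ::
    "oracle_tm \<Rightarrow> (bool list \<Rightarrow> bool list) \<Rightarrow> bool list \<Rightarrow> nat \<Rightarrow> bool list \<Rightarrow> bool" where
  "outputs_in M orc w t a \<longleftrightarrow>
     (\<exists>ts. (step M orc ^^ t) (init_config M w) = (halt_state M, ts) \<and> tape_word (ts ! 0) = a)"

text \<open>A function problem is given by the pairs of an encoded instance and its encoded answer;
  words that do not encode an instance may receive any answer.\<close>

type_synonym problem = "(bool list \<times> bool list) set"

definition solves :: "(bool list \<Rightarrow> bool list) \<Rightarrow> problem \<Rightarrow> bool" where
  "solves orc P \<longleftrightarrow> (\<forall>(w, a) \<in> P. orc w = a)"

definition poly_time_reducible :: "problem \<Rightarrow> problem \<Rightarrow> bool" where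
  "poly_time_reducible P Q \<longleftrightarrow>
     (\<exists>M (b :: nat poly). wf_oracle_tm M \<and>
        (\<forall>orc. solves orc Q \<longrightarrow>
           (\<forall>(w, a) \<in> P. \<exists>t \<le> poly b (length w). outputs_in M orc w t a)))"


section \<open>Counting problems on bipartite graphs\<close>

text \<open>An instance with \<open>n\<close> left and \<open>m\<close> right vertices is written as \<open>n\<close> and \<open>m\<close> followed by a
  list of its edges, where \<open>(i, j)\<close> joins the \<open>i\<close>-th left to the \<open>j\<close>-th right vertex. Numbers
  are in unary, which changes the length of the word only polynomially.\<close>

definition instance_graph :: "nat \<Rightarrow> nat \<Rightarrow> (nat \<times> nat) list \<Rightarrow> nat bigraph" where
  "instance_graph n m es =
     \<lparr>lpart = {0..<n}, rpart = {n..<n + m}, edges = (\<lambda>(i, j). (i, n + j)) ` set es\<rparr>"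

definition unary :: "nat \<Rightarrow> bool list" where
  "unary n = replicate n True @ [False]"

definition encode_instance :: "nat \<Rightarrow> nat \<Rightarrow> (nat \<times> nat) list \<Rightarrow> bool list" where
  "encode_instance n m es =
     unary n @ unary m @ concat (map (\<lambda>(i, j). unary i @ unary j) es)"

text \<open>Answers are residues modulo a fixed prime, hence bounded, and are written in unary.\<close>

definition graph_problem :: "(nat bigraph \<Rightarrow> nat) \<Rightarrow> problem" where
  "graph_problem F =
     {(encode_instance n m es, unary (F (instance_graph n m es))) | n m es.
        set es \<subseteq> {0..<n} \<times> {0..<m}}"

definition CSP_mod :: "nat \<Rightarrow> 'v bigraph \<Rightarrow> problem" where
  "CSP_mod p H = graph_problem (\<lambda>G. card (homs G H) mod p)"

definition independent_sets :: "'v bigraph \<Rightarrow> 'v set set" where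
  "independent_sets G = {I. I \<subseteq> verts G \<and> (\<forall>(u, v) \<in> edges G. \<not> (u \<in> I \<and> v \<in> I))}"

definition BIS_mod :: "nat \<Rightarrow> int \<Rightarrow> int \<Rightarrow> problem" where
  "BIS_mod p \<alpha> \<beta> = graph_problem (\<lambda>G.
     nat ((\<Sum>I \<in> independent_sets G. \<alpha> ^ card (I \<inter> lpart G) * \<beta> ^ card (I \<inter> rpart G)) mod int p))"

text \<open>The encoding is injective, so every counting problem is solved by some oracle and the
  quantification over oracles in \<^const>\<open>poly_time_reducible\<close> is not vacuous.\<close>

lemma unary_append_inject: "unary n @ xs = unary m @ ys \<longleftrightarrow> n = m \<and> xs = ys"
proof (induction n arbitrary: m)
  case 0
  then show ?case by (cases m) (auto simp: unary_def)
next
  case (Suc n)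
  then show ?case by (cases m) (auto simp: unary_def)
qed

lemma encode_edges_inject:
  "concat (map (\<lambda>(i, j). unary i @ unary j) es) = concat (map (\<lambda>(i, j). unary i @ unary j) fs)
    \<longleftrightarrow> es = fs"
proof (induction es arbitrary: fs)
  case Nil
  then show ?case by (cases fs) (auto simp: unary_def)
next
  case (Cons e es)
  show ?case
  proof (cases fs)
    case Nil
    then show ?thesis by (auto simp: unary_def split: prod.splits)
  next
    case (Cons f fs')
    with Cons.IH[of fs'] show ?thesis
      by (cases e; cases f) (simp add: unary_append_inject)
  qed
qed

lemma encode_instance_inject:
  "encode_instance n m es = encode_instance n' m' es' \<longleftrightarrow> n = n' \<and> m = m' \<and> es = es'"
  by (simp add: encode_instance_def unary_append_inject encode_edges_inject)

lemma graph_problem_solvable: "\<exists>orc. solves orc (graph_problem F)"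
proof
  show "solves (\<lambda>w. THE a. (w, a) \<in> graph_problem F) (graph_problem F)"
    by (auto simp: solves_def graph_problem_def encode_instance_inject intro!: the_equality)
qed

lemma bigraph_instance_graph:
  "set es \<subseteq> {0..<n} \<times> {0..<m} \<Longrightarrow> bigraph (instance_graph n m es)"
  by (auto simp: bigraph_def instance_graph_def)

end

theory Submission
  imports Defs
begin

text \<open>Attach a copy of \<open>(KL, x)\<close> to every left vertex of the given graph \<open>G\<close> and a copy of
  \<open>(KR, y)\<close> to every right vertex. A homomorphism of the resulting graph to \<open>H\<close> restricts to a
  map \<open>\<phi>\<close> of the vertices of \<open>G\<close>, and the number of its extensions is the product of the numbers
  \<open>hom_at\<close> over all vertices of \<open>G\<close>; modulo \<open>p\<close> only those \<open>\<phi>\<close> count that map into the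
  thick Z-graph. There, \<open>\<phi>\<close> respects the edges iff the vertices sent to \<open>A \<union> D\<close> form an
  independent set \<open>I\<close>, and the maps belonging to \<open>I\<close> have total weight
  \<open>\<alpha>1\<close>, \<open>\<alpha>2\<close>, \<open>\<beta>1\<close>, \<open>\<beta>2\<close> to the powers \<open>|I \<inter> L|\<close>, \<open>|L - I|\<close>, \<open>|I \<inter> R|\<close>, \<open>|R - I|\<close>.
  Dividing the answer for the larger graph by \<open>\<alpha>2\<close> and \<open>\<beta>2\<close> to the powers \<open>n\<close> and \<open>m\<close>
  gives the weighted number of independent sets.\<close>

text \<open>The weights come out as ratios because \<open>C\<close> and \<open>B\<close> are the
  neutral choices: they are joined to everything on the other side of the thick Z-graph, and only
  the pair \<open>A\<close>, \<open>D\<close> is forbidden. A vertex outside the set thus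
  contributes \<alpha>2 or \<beta>2, and one inside replaces that factor by \<alpha>1 or \<beta>1.
  Non-degeneracy does not say on which side of their graphs \<open>x\<close> and \<open>y\<close>
  lie. The nonzero counts into \<open>A\<close> and \<open>D\<close> decide it, and only then can
  the edges of \<open>G\<close> be drawn between copies of \<open>x\<close> and copies of
  \<open>y\<close>. Since reducibility means a concrete oracle Turing machine, the construction has
  to be programmable with little effort. One query suffices. The gadgets, \<open>H\<close> and
  \<open>p\<close> are fixed, so gadget sizes, gadget edges and the two inverses are constants of
  the program. Every number in the query is a linear combination, with constant natural
  coefficients, of a few counters, and in unary such a sum is a concatenation of blocks of ones;
  increments, decrements and tests for zero are enough to write it.\<close>

subsection \<open>Programs for oracle machines\<close>

text \<open>Lists of cells that differ only in trailing blanks describe the same tape. As functions, whose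
  first component lists the cells left of the head, equal tapes are equal terms.\<close>

type_synonym ftape = "(nat \<Rightarrow> bool option) \<times> (nat \<Rightarrow> bool option)"

definition cell :: "bool option list \<Rightarrow> nat \<Rightarrow> bool option" where
  "cell xs i = (if i < length xs then xs ! i else None)"

fun cells :: "tape \<Rightarrow> ftape" where
  "cells (l, r) = (cell l, cell r)"

text \<open>The two \<open>MoveLeft\<close> equations of \<open>act\<close> become one here: an
  exhausted left list reads as \<open>None\<close>, which is the blank that \<open>act\<close> has
  to insert explicitly.\<close>

fun write_move :: "bool option \<times> move \<Rightarrow> ftape \<Rightarrow> ftape" where
  "write_move (s, Stay) (L, R) = (L, R(0 := s))"
| "write_move (s, MoveRight) (L, R) = (case_nat s L, \<lambda>i. R (Suc i))"
| "write_move (s, MoveLeft) (L, R) = (\<lambda>i. L (Suc i), case_nat (L 0) (R(0 := s)))"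

definition heads :: "ftape list \<Rightarrow> bool option list" where
  "heads ts = map (\<lambda>t. snd t 0) ts"

lemma length_heads [simp]: "length (heads ts) = length ts"
  by (simp add: heads_def)

lemma nth_heads [simp]: "k < length ts \<Longrightarrow> heads ts ! k = snd (ts ! k) 0"
  by (simp add: heads_def)

lemma case_nat_cell [simp]: "case_nat s (cell l) = cell (s # l)"
  by (auto simp: cell_def fun_eq_iff split: nat.splits)

lemma cell_simps [simp]:
  "(\<lambda>i. cell (x # l) (Suc i)) = cell l"
  "(\<lambda>i. cell [] (Suc i)) = cell []"
  "(cell (x # l))(0 := s) = cell (s # l)"
  "(cell [])(0 := s) = cell [s]"
  "cell (x # l) 0 = x"
  "cell [] 0 = None"
  by (auto simp: cell_def fun_eq_iff nth_Cons split: nat.splits)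

lemma cell_Cons_Suc: "cell (x # l) (Suc i) = cell l i"
  by (simp add: cell_def)

lemma cell_snoc_None [simp]: "cell (l @ [None]) = cell l" "cell [None] = cell []"
  "cell [x, None] = cell [x]"
  by (auto simp: cell_def fun_eq_iff nth_append nth_Cons split: nat.splits)

lemma cells_act: "cells (act a t) = write_move a (cells t)"
proof (cases t; cases a)
  fix l r s m assume t: "t = (l, r)" and a: "a = (s, m)"
  show ?thesis
    by (cases m; cases l; cases r) (simp_all add: t a)
qed

lemma head_cells: "head_symbol t = snd (cells t) 0"
  by (cases t rule: head_symbol.cases) simp_all

lemma map_head_symbol: "map head_symbol ts = heads (map cells ts)"
  by (simp add: heads_def head_cells)

text \<open>The function \<open>cell r\<close> hides trailing blanks of \<open>r\<close>, but
  \<open>map Some w\<close> has no blank inside, so the first blank of \<open>r\<close> is exactly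
  where \<open>w\<close> ends, whether it is stored or implicit.\<close>

lemma takeWhile_cell:
  "cell r = cell (map Some w) \<Longrightarrow> map the (takeWhile (\<lambda>s. s \<noteq> None) r) = w"
proof (induction w arbitrary: r)
  case Nil
  then show ?case
    by (cases r) (auto dest: fun_cong[where x = 0])
next
  case (Cons b w)
  show ?case
  proof (cases r)
    case Nil
    with Cons.prems show ?thesis by (auto dest: fun_cong[where x = 0])
  next
    case (Cons s r')
    have "cell r' = cell (map Some w)"
    proof
      fix i show "cell r' i = cell (map Some w) i"
        using fun_cong[OF Cons.prems, of "Suc i"] by (simp add: Cons cell_Cons_Suc)
    qed
    moreover have "s = Some b"
      using fun_cong[OF Cons.prems, of 0] by (simp add: Cons)
    ultimately show ?thesis
      using Cons.IH by (simp add: Cons)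
  qed
qed

lemma tape_word_cells: "snd (cells t) = cell (map Some w) \<Longrightarrow> tape_word t = w"
  by (cases t) (use takeWhile_cell in simp)

lemma map_cells_act:
  "map cells (map2 act as ts) = map2 write_move as (map cells ts)"
  by (induction as ts rule: list_induct2') (simp_all add: cells_act)

text \<open>Writing back the symbols just read changes nothing, so overwriting single entries of
  \<open>stay ss\<close> gives an action on selected tapes only.\<close>

definition stay :: "bool option list \<Rightarrow> (bool option \<times> move) list" where
  "stay ss = map (\<lambda>s. (s, Stay)) ss"

lemma length_stay [simp]: "length (stay ss) = length ss"
  by (simp add: stay_def)

lemma write_move_stay [simp]: "write_move (snd t 0, Stay) t = t"
  by (cases t) simp

lemma map2_stay: "map2 write_move (stay (heads ts)) ts = ts"
  by (rule nth_equalityI) (simp_all add: stay_def)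

lemma map2_stay_update:
  "k < length ts \<Longrightarrow>
   map2 write_move ((stay (heads ts))[k := a]) ts = ts[k := write_move a (ts ! k)]"
  by (rule nth_equalityI) (auto simp: stay_def nth_list_update)

lemma map2_stay_update2:
  assumes "k < length ts" "l < length ts" "k \<noteq> l"
  shows "map2 write_move ((stay (heads ts))[k := a, l := b]) ts
    = ts[k := write_move a (ts ! k), l := write_move b (ts ! l)]"
  by (rule nth_equalityI) (use assms in \<open>auto simp: stay_def nth_list_update\<close>)

text \<open>The control state of a machine running such a program consists of the list of commands still
  to be executed and a number. \<open>Act f\<close> is a single step of the machine; \<open>f\<close> maps the number and
  the symbols under the heads to the new number and the actions on the tapes.\<close>

datatype com =
    Act "nat \<Rightarrow> bool option list \<Rightarrow> nat \<times> (bool option \<times> move) list"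
  | While "nat \<Rightarrow> bool option list \<Rightarrow> bool" "com list"
  | Query

section \<open>Command stacks that can occur during execution\<close>

fun next_stacks :: "com list \<Rightarrow> com list set" where
  "next_stacks [] = {}"
| "next_stacks (Act f # k) = {k}"
| "next_stacks (While b cs # k) = {cs @ While b cs # k, k}"
| "next_stacks (Query # k) = {k}"

text \<open>A superset of the command lists that can remain during the execution of a program. It is
  finite, which is what turns a program into a machine with finitely many states.\<close>

fun com_stacks :: "com \<Rightarrow> com list set" and list_stacks :: "com list \<Rightarrow> com list set" where
  "com_stacks (Act f) = {[Act f]}"
| "com_stacks Query = {[Query]}"
| "com_stacks (While b cs) = (\<lambda>xs. xs @ [While b cs]) ` list_stacks cs"
| "list_stacks [] = {[]}"
| "list_stacks (c # cs) = (\<lambda>xs. xs @ cs) ` com_stacks c \<union> list_stacks cs"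

lemma finite_stacks: "finite (com_stacks c)" "finite (list_stacks cs)"
  by (induction c and cs rule: com_stacks_list_stacks.induct) auto

lemma self_list_stacks: "[c] \<in> com_stacks c" "cs \<in> list_stacks cs \<and> [] \<in> list_stacks cs"
  by (induction c and cs rule: com_stacks_list_stacks.induct) (force simp: image_iff)+

lemma suffix_list_stacks: "ys \<in> list_stacks (xs @ ys)"
  by (induction xs) (simp_all add: self_list_stacks)

lemma append_next_stacks:
  "xs \<noteq> [] \<Longrightarrow> next_stacks (xs @ k) = (\<lambda>ys. ys @ k) ` next_stacks xs"
  by (cases xs rule: next_stacks.cases) auto

text \<open>A step inside a single command either stays within it or finishes it, whence the extra
  \<open>[]\<close> in the first claim. Within a list, finishing the first command exposes the
  remaining list, which \<open>list_stacks\<close> contains; within a loop body, finishing it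
  exposes the loop itself.\<close>

lemma stacks_closed:
  "xs \<in> com_stacks c \<Longrightarrow> next_stacks xs \<subseteq> insert [] (com_stacks c)"
  "xs \<in> list_stacks cs \<Longrightarrow> next_stacks xs \<subseteq> list_stacks cs"
proof (induction c and cs arbitrary: xs and xs rule: com_stacks_list_stacks.induct)
  case (3 b cs)
  then obtain ys where ys: "ys \<in> list_stacks cs" "xs = ys @ [While b cs]" by auto
  show ?case
  proof (cases "ys = []")
    case True
    then show ?thesis using ys self_list_stacks(2)[of cs] by auto
  next
    case False
    then show ?thesis using 3(1)[OF ys(1)] ys by (auto simp: append_next_stacks)
  qed
next
  case (5 c cs)
  from 5(3) consider (a) ys where "ys \<in> com_stacks c" "xs = ys @ cs" | (b) "xs \<in> list_stacks cs"
    by auto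
  then show ?case
  proof cases
    case a
    show ?thesis
    proof (cases "ys = []")
      case True
      then show ?thesis using a 5(2)[of cs] self_list_stacks(2)[of cs] by auto
    next
      case False
      then show ?thesis using 5(1)[OF a(1)] a self_list_stacks(2)[of cs]
        by (auto simp: append_next_stacks)
    qed
  next
    case b
    then show ?thesis using 5(2) by auto
  qed
qed auto

text \<open>\<open>R\<close> bounds the number in the control, which keeps the state set finite;
  \<open>K\<close> is the number of tapes, and action lists of another length would be cut or would
  cut the tapes in \<open>map2\<close>.\<close>

fun com_wf :: "nat \<Rightarrow> nat \<Rightarrow> com \<Rightarrow> bool" where
  "com_wf R K (Act f) \<longleftrightarrow>
     (\<forall>r ss. r < R \<and> length ss = K \<longrightarrow> fst (f r ss) < R \<and> length (snd (f r ss)) = K)"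
| "com_wf R K (While b cs) \<longleftrightarrow> (\<forall>c \<in> set cs. com_wf R K c)"
| "com_wf R K Query \<longleftrightarrow> True"

lemma stacks_wf:
  "com_wf R K c \<Longrightarrow> xs \<in> com_stacks c \<Longrightarrow> \<forall>c' \<in> set xs. com_wf R K c'"
  "\<forall>c \<in> set cs. com_wf R K c \<Longrightarrow> xs \<in> list_stacks cs \<Longrightarrow> \<forall>c' \<in> set xs. com_wf R K c'"
proof (induction c and cs arbitrary: xs and xs rule: com_stacks_list_stacks.induct)
  case (5 c cs)
  from 5(4) consider (a) ys where "ys \<in> com_stacks c" "xs = ys @ cs" | (b) "xs \<in> list_stacks cs"
    by auto
  then show ?case
    by cases (use 5(1-3) in auto)
qed auto

section \<open>Execution of programs with time bounds\<close>

type_synonym fconfig = "com list \<times> nat \<times> ftape list"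

text \<open>The last equation makes both the empty stack and a pending \<open>Query\<close> fixed
  points. Execution by \<open>fstep\<close> is therefore independent of the oracle, whose single
  step is inserted between two runs.\<close>

fun fstep :: "fconfig \<Rightarrow> fconfig" where
  "fstep (Act f # k, r, ts) =
     (k, fst (f r (heads ts)), map2 write_move (snd (f r (heads ts))) ts)"
| "fstep (While b cs # k, r, ts) = (if b r (heads ts) then cs @ While b cs # k else k, r, ts)"
| "fstep c = c"

text \<open>Quantifying over the continuation \<open>k\<close> makes runs composable, and asking
  only for an upper bound on the time lets bounds be rounded up.\<close>

definition runs :: "com list \<Rightarrow> nat \<times> ftape list \<Rightarrow> nat \<Rightarrow> nat \<times> ftape list \<Rightarrow> bool" where
  "runs cs s B s' \<longleftrightarrow> (\<forall>k. \<exists>t \<le> B. (fstep ^^ t) (cs @ k, s) = (k, s'))"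

lemma runs_mono: "runs cs s B s' \<Longrightarrow> B \<le> B' \<Longrightarrow> runs cs s B' s'"
  unfolding runs_def by (meson le_trans)

lemma runs_Nil: "runs [] s B s"
  unfolding runs_def by (auto intro!: exI[of _ 0])

lemma runs_append:
  assumes "runs cs s B1 s1" "runs ds s1 B2 s2"
  shows "runs (cs @ ds) s (B1 + B2) s2"
  unfolding runs_def
proof
  fix k
  obtain t1 where 1: "t1 \<le> B1" "(fstep ^^ t1) (cs @ ds @ k, s) = (ds @ k, s1)"
    using assms(1) unfolding runs_def by blast
  obtain t2 where 2: "t2 \<le> B2" "(fstep ^^ t2) (ds @ k, s1) = (k, s2)"
    using assms(2) unfolding runs_def by blast
  have "(fstep ^^ (t2 + t1)) ((cs @ ds) @ k, s) = (k, s2)"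
    using 1 2 by (simp add: funpow_add)
  then show "\<exists>t \<le> B1 + B2. (fstep ^^ t) ((cs @ ds) @ k, s) = (k, s2)"
    using 1(1) 2(1) by (intro exI[of _ "t2 + t1"]) simp
qed

lemma runs_Cons:
  "runs [c] s B1 s1 \<Longrightarrow> runs ds s1 B2 s2 \<Longrightarrow> runs (c # ds) s (B1 + B2) s2"
  using runs_append[of "[c]"] by simp

lemma runs_Act:
  "f r (heads ts) = (r', as) \<Longrightarrow> runs [Act f] (r, ts) 1 (r', map2 write_move as ts)"
  unfolding runs_def by (intro allI exI[of _ 1]) simp

lemma runs_While_False: "\<not> b r (heads ts) \<Longrightarrow> runs [While b cs] (r, ts) 1 (r, ts)"
  unfolding runs_def by (intro allI exI[of _ 1]) simp

lemma runs_While_True: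
  assumes "b r (heads ts)" "runs (cs @ [While b cs]) (r, ts) B s"
  shows "runs [While b cs] (r, ts) (Suc B) s"
  unfolding runs_def
proof
  fix k
  obtain t where "t \<le> B" "(fstep ^^ t) ((cs @ [While b cs]) @ k, r, ts) = (k, s)"
    using assms(2) unfolding runs_def by blast
  then show "\<exists>t \<le> Suc B. (fstep ^^ t) ([While b cs] @ k, r, ts) = (k, s)"
    using assms(1) by (intro exI[of _ "Suc t"]) (simp add: funpow_Suc_right del: funpow.simps)
qed

text \<open>\<open>S v\<close> is the state with \<open>v\<close> iterations left, so the caller
  supplies an invariant indexed by a countdown. Each iteration costs its body and one test; the
  final 1 is the failing test.\<close>

lemma runs_While_count:
  assumes "\<And>v. v < V \<Longrightarrow> b (fst (S (Suc v))) (heads (snd (S (Suc v))))"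
    and "\<And>v. v < V \<Longrightarrow> runs cs (S (Suc v)) B (S v)"
    and "\<not> b (fst (S 0)) (heads (snd (S 0)))"
  shows "runs [While b cs] (S V) (V * (B + 1) + 1) (S 0)"
  using assms
proof (induction V)
  case 0
  then show ?case using runs_While_False[of b "fst (S 0)" "snd (S 0)"] by simp
next
  case (Suc V)
  have "runs [While b cs] (S V) (V * (B + 1) + 1) (S 0)"
    using Suc by simp
  then have "runs (cs @ [While b cs]) (S (Suc V)) (B + (V * (B + 1) + 1)) (S 0)"
    by (intro runs_append[OF Suc.prems(2)]) auto
  then have "runs [While b cs] (S (Suc V)) (Suc (B + (V * (B + 1) + 1))) (S 0)"
    using runs_While_True[of b "fst (S (Suc V))" "snd (S (Suc V))"] Suc.prems(1)[of V] by simp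
  then show ?case by (rule runs_mono) simp
qed

text \<open>The machine executes \<open>P1\<close>, asks one query, and executes \<open>P2\<close>;
  the extra 1 in the time bound is the query step. Its states are numbered pairs of a possible
  command stack and a number below \<open>R\<close>.\<close>

lemma ex_oracle_tm_program:
  assumes wf: "\<forall>c \<in> set (P1 @ P2). com_wf R K c" and K: "2 \<le> K" and R: "0 < R"
  obtains M where "wf_oracle_tm M"
    "\<And>orc w s1 B1 a s2 B2 L W.
      \<lbrakk>runs P1 (0, (cell [], cell (map Some w)) # replicate (K - 1) (cell [], cell [])) B1 (0, s1);
       length s1 = K; s1 ! 1 = (L, cell (map Some W));
       runs P2 (0, s1[1 := (cell [], cell (map Some (orc W)))]) B2 (0, s2);
       length s2 = K; snd (s2 ! 0) = cell (map Some a)\<rbrakk>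
      \<Longrightarrow> \<exists>t \<le> B1 + B2 + 1. outputs_in M orc w t a"
proof -
  define Q where "Q = list_stacks (P1 @ Query # P2) \<times> {..<R}"
  have finQ: "finite Q" by (simp add: Q_def finite_stacks)
  then obtain enc where enc: "bij_betw enc Q {0..<card Q}"
    using ex_bij_betw_finite_nat by blast
  define dec where "dec = the_inv_into Q enc"
  have inj: "inj_on enc Q" using enc by (rule bij_betw_imp_inj_on)
  have dec[simp]: "dec (enc x) = x" if "x \<in> Q" for x
    unfolding dec_def using inj that by (rule the_inv_into_f_f)
  have encless: "enc x < card Q" if "x \<in> Q" for x
    using enc that bij_betwE by fastforce
  have dec_in: "dec q \<in> Q" if "q < card Q" for q
    unfolding dec_def using enc that the_inv_into_into[OF inj, of q Q] by (auto simp: bij_betw_def)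
  have eq_iff: "enc x = enc y \<longleftrightarrow> x = y" if "x \<in> Q" "y \<in> Q" for x y
    using inj that by (auto dest: inj_onD)
  \<comment> \<open>The default case idles on an empty stack or at a \<open>Query\<close>, just as
    \<open>fstep\<close> does.\<close>
  define tr where "tr q ss = (case dec q of
      (Act f # k, r) \<Rightarrow> (enc (k, fst (f r ss)), snd (f r ss))
    | (While b cs # k, r) \<Rightarrow> (enc (if b r ss then cs @ While b cs # k else k, r), stay ss)
    | _ \<Rightarrow> (q, stay ss))" for q ss
  \<comment> \<open>Halting and querying are single states, both with number 0; this is why the runs
    of \<open>P1\<close> and of \<open>P2\<close> are required to end with 0 in the control.\<close>
  define M where "M = \<lparr>num_tapes = K, num_states = card Q, start_state = enc (P1 @ Query # P2, 0),
    halt_state = enc ([], 0), query_state = enc (Query # P2, 0), answer_state = enc (P2, 0),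
    trans = tr\<rparr>"
  have inQ: "(P1 @ Query # P2, 0) \<in> Q" "([], 0) \<in> Q" "(Query # P2, 0) \<in> Q" "(P2, 0) \<in> Q"
    using R suffix_list_stacks[of "P1 @ Query # P2" "[]"] suffix_list_stacks[of "Query # P2" P1]
      suffix_list_stacks[of P2 "P1 @ [Query]"] self_list_stacks(2)[of "P1 @ Query # P2"]
    by (simp_all add: Q_def)
  have wfQ: "\<forall>c \<in> set xs. com_wf R K c" if "(xs, r) \<in> Q" for xs r
    using that wf stacks_wf(2)[of "P1 @ Query # P2" R K xs] by (simp add: Q_def)
  have nextQ: "(ys, r') \<in> Q" if "(xs, r) \<in> Q" "ys \<in> next_stacks xs" "r' < R" for xs r ys r'
    using that stacks_closed(2)[of xs "P1 @ Query # P2"] by (auto simp: Q_def)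
  have tr_ok: "fst (tr q ss) < card Q \<and> length (snd (tr q ss)) = K"
    if "q < card Q" "length ss = K" for q ss
  proof -
    obtain xs r where d: "dec q = (xs, r)" by (cases "dec q")
    then have xr: "(xs, r) \<in> Q" using dec_in[OF that(1)] by simp
    then have "r < R" by (simp add: Q_def)
    show ?thesis
      by (cases xs rule: next_stacks.cases)
        (use d xr that \<open>r < R\<close> wfQ[OF xr] in \<open>auto simp: tr_def intro!: encless intro: nextQ\<close>)
  qed
  have wfM: "wf_oracle_tm M"
    using K inQ tr_ok by (auto simp: wf_oracle_tm_def M_def encless)
  define rel where "rel cf fc \<longleftrightarrow> (case cf of (q, tps) \<Rightarrow> case fc of (xs, r, ts) \<Rightarrow>
    (xs, r) \<in> Q \<and> q = enc (xs, r) \<and> ts = map cells tps \<and> length tps = K)"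
    for cf :: config and fc :: fconfig
  have sim1: "\<exists>t \<le> 1. rel ((step M orc ^^ t) cf) (fstep fc)" if "rel cf fc" for orc cf fc
  proof -
    obtain q tps where cf: "cf = (q, tps)" by (cases cf)
    obtain xs r ts where fc: "fc = (xs, r, ts)" by (cases fc)
    from that have xr: "(xs, r) \<in> Q" and q: "q = enc (xs, r)" and ts: "ts = map cells tps"
      and len: "length tps = K" by (auto simp: rel_def cf fc)
    have rR: "r < R" using xr by (simp add: Q_def)
    show ?thesis
    proof (cases xs rule: next_stacks.cases)
      \<comment> \<open>Where \<open>fstep\<close> idles, the machine takes no step at all.
        Otherwise it would ask the oracle at the wrong time in the simulation.\<close>
      case 1
      then show ?thesis using that by (auto simp: fc intro!: exI[of _ 0])
    next
      case (4 k)
      then show ?thesis using that by (auto simp: fc intro!: exI[of _ 0])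
    next
      case (2 f k)
      obtain r' as where f: "f r (heads ts) = (r', as)" by (cases "f r (heads ts)")
      have "length (heads ts) = K" using len ts by simp
      moreover have "com_wf R K (Act f)" using wfQ[OF xr] 2 by simp
      ultimately have "fst (f r (heads ts)) < R \<and> length (snd (f r (heads ts))) = K"
        using rR unfolding com_wf.simps by blast
      then have "r' < R" "length as = K" using f by simp_all
      moreover have "step M orc cf = (enc (k, r'), map2 act as tps)"
        using xr inQ f by (simp add: cf q M_def eq_iff 2 tr_def map_head_symbol ts[symmetric])
      moreover have "(k, r') \<in> Q" using nextQ[OF xr] \<open>r' < R\<close> by (simp add: 2)
      ultimately have "rel ((step M orc ^^ 1) cf) (fstep fc)"
        using len f by (simp add: rel_def fc 2 map_cells_act ts[symmetric] del: map_map)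
      then show ?thesis by blast
    next
      case (3 b cs k)
      define ys where "ys = (if b r (heads ts) then cs @ While b cs # k else k)"
      have "step M orc cf = (enc (ys, r), map2 act (stay (heads ts)) tps)"
        using xr inQ by (simp add: cf q M_def eq_iff 3 tr_def map_head_symbol ts[symmetric] ys_def)
      moreover have "(ys, r) \<in> Q" using nextQ[OF xr] rR by (simp add: 3 ys_def)
      moreover have "map cells (map2 act (stay (heads ts)) tps) = ts"
        by (simp add: map_cells_act ts[symmetric] map2_stay del: map_map)
      ultimately have "rel ((step M orc ^^ 1) cf) (fstep fc)"
        using len ts by (auto simp: rel_def fc 3 ys_def)
      then show ?thesis by blast
    qed
  qed
  have sim: "\<exists>t' \<le> t. rel ((step M orc ^^ t') cf) ((fstep ^^ t) fc)" if "rel cf fc" for orc cf fc t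
  proof (induction t)
    case 0
    then show ?case using that by simp
  next
    case (Suc t)
    then obtain t' where t': "t' \<le> t" "rel ((step M orc ^^ t') cf) ((fstep ^^ t) fc)" by blast
    from sim1[OF t'(2), of orc] obtain t'' where "t'' \<le> 1"
      "rel ((step M orc ^^ t'') ((step M orc ^^ t') cf)) (fstep ((fstep ^^ t) fc))" by blast
    with t' show ?case
      by (intro exI[of _ "t'' + t'"]) (simp add: funpow_add)
  qed
  show thesis
  proof (rule that[OF wfM])
    fix orc w s1 B1 a s2 B2 L W
    assume r1: "runs P1 (0, (cell [], cell (map Some w)) # replicate (K - 1) (cell [], cell [])) B1 (0, s1)"
      and s1: "length s1 = K" "s1 ! 1 = (L, cell (map Some W))"
      and r2: "runs P2 (0, s1[1 := (cell [], cell (map Some (orc W)))]) B2 (0, s2)"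
      and s2: "length s2 = K" "snd (s2 ! 0) = cell (map Some a)"
    have "rel (init_config M w) (P1 @ Query # P2, 0,
        (cell [], cell (map Some w)) # replicate (K - 1) (cell [], cell []))"
      using inQ K by (simp add: rel_def init_config_def M_def)
    moreover obtain t1 where t1: "t1 \<le> B1" "(fstep ^^ t1) (P1 @ Query # P2, 0,
        (cell [], cell (map Some w)) # replicate (K - 1) (cell [], cell [])) = (Query # P2, 0, s1)"
      using r1 unfolding runs_def by blast
    ultimately obtain u1 where u1: "u1 \<le> t1" "rel ((step M orc ^^ u1) (init_config M w)) (Query # P2, 0, s1)"
      using sim by metis
    obtain tps where c1: "(step M orc ^^ u1) (init_config M w) = (enc (Query # P2, 0), tps)"
      "s1 = map cells tps" "length tps = K"
      using u1(2) by (auto simp: rel_def split: prod.splits)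
    have "snd (cells (tps ! 1)) = cell (map Some W)"
      using s1 c1 K by auto
    then have "tape_word (tps ! 1) = W" by (rule tape_word_cells)
    then have "step M orc (enc (Query # P2, 0), tps) = (enc (P2, 0), tps[1 := ([], map Some (orc W))])"
      using inQ by (simp add: M_def eq_iff)
    then have c2: "(step M orc ^^ Suc u1) (init_config M w)
        = (enc (P2, 0), tps[1 := ([], map Some (orc W))])"
      using c1 by simp
    have "rel (enc (P2, 0), tps[1 := ([], map Some (orc W))])
        (P2, 0, s1[1 := (cell [], cell (map Some (orc W)))])"
      using inQ c1 by (simp add: rel_def map_update)
    moreover obtain t2 where t2: "t2 \<le> B2"
        "(fstep ^^ t2) (P2, 0, s1[1 := (cell [], cell (map Some (orc W)))]) = ([], 0, s2)"
      using r2 unfolding runs_def by (metis append_Nil2)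
    ultimately obtain u2 where u2: "u2 \<le> t2" "rel ((step M orc ^^ u2)
        (enc (P2, 0), tps[1 := ([], map Some (orc W))])) ([], 0, s2)"
      using sim by metis
    then obtain tps2 where c3: "(step M orc ^^ u2) (enc (P2, 0), tps[1 := ([], map Some (orc W))])
        = (enc ([], 0), tps2)" "s2 = map cells tps2" "length tps2 = K"
      by (auto simp: rel_def split: prod.splits)
    have "snd (cells (tps2 ! 0)) = cell (map Some a)"
      using s2 c3 K by auto
    then have "tape_word (tps2 ! 0) = a" by (rule tape_word_cells)
    moreover have "(step M orc ^^ (u2 + Suc u1)) (init_config M w) = (halt_state M, tps2)"
    proof -
      have "(step M orc ^^ (u2 + Suc u1)) (init_config M w)
          = (step M orc ^^ u2) ((step M orc ^^ Suc u1) (init_config M w))"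
        by (simp only: funpow_add comp_apply)
      then show ?thesis unfolding c2 c3(1) by (simp add: M_def)
    qed
    ultimately have "outputs_in M orc w (u2 + Suc u1) a"
      unfolding outputs_in_def by blast
    then show "\<exists>t \<le> B1 + B2 + 1. outputs_in M orc w t a"
      using u1 u2 t1 t2 by (intro exI[of _ "u2 + Suc u1"]) simp
  qed
qed

subsection \<open>The program of the reduction\<close>

definition tape_op ::
    "(nat \<Rightarrow> nat) \<Rightarrow> nat \<Rightarrow> (bool option \<Rightarrow> bool option \<times> move) \<Rightarrow> com" where
  "tape_op \<rho> k g = Act (\<lambda>r ss. (\<rho> r, (stay ss)[k := g (ss ! k)]))"

lemma runs_tape_op:
  "k < length ts \<Longrightarrow>
   runs [tape_op \<rho> k g] (r, ts) 1 (\<rho> r, ts[k := write_move (g (snd (ts ! k) 0)) (ts ! k)])"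
  using runs_Act[of "\<lambda>r ss. (\<rho> r, (stay ss)[k := g (ss ! k)])" r ts]
  by (simp add: tape_op_def map2_stay_update)

lemma wf_tape_op: "(\<And>r. r < R \<Longrightarrow> \<rho> r < R) \<Longrightarrow> com_wf R K (tape_op \<rho> k g)"
  by (simp add: tape_op_def)

definition inp :: "bool list \<Rightarrow> ftape" where
  "inp w = (cell [], cell (map Some w))"

text \<open>A word under construction: the head is just behind its last bit, so the word lies
  reversed in the left part.\<close>

definition outp :: "bool list \<Rightarrow> ftape" where
  "outp u = (cell (map Some (rev u)), cell [])"

text \<open>The head of a counter tape rests on the last of its ones.\<close>

definition ctr :: "nat \<Rightarrow> ftape" where
  "ctr v = (cell (replicate (v - 1) (Some True)), cell (if v = 0 then [] else [Some True]))"

definition st :: "ftape \<Rightarrow> ftape \<Rightarrow> (nat \<Rightarrow> nat) \<Rightarrow> ftape list" where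
  "st a b c = a # b # map (\<lambda>k. ctr (c k)) [0..<5]"

lemma length_st [simp]: "length (st a b c) = 7"
  by (simp add: st_def)

lemma nth_st [simp]:
  "st a b c ! 0 = a" "st a b c ! Suc 0 = b" "k < 5 \<Longrightarrow> st a b c ! Suc (Suc k) = ctr (c k)"
  by (simp_all add: st_def)

lemma nth_st_4 [simp]: "st a b c ! 4 = ctr (c 2)"
  using nth_st(3)[of 2 a b c] by simp

lemma st_update [simp]:
  "(st a b c)[0 := x] = st x b c"
  "(st a b c)[Suc 0 := x] = st a x c"
  by (simp_all add: st_def)

lemma st_update_ctr [simp]:
  "k < 5 \<Longrightarrow> (st a b c)[Suc (Suc k) := ctr v] = st a b (c(k := v))"
  by (rule nth_equalityI) (auto simp: st_def nth_Cons nth_list_update split: nat.splits)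

section \<open>Elementary operations on words and counters\<close>

abbreviation nonzero :: "nat \<Rightarrow> nat \<Rightarrow> bool option list \<Rightarrow> bool" where
  "nonzero k \<equiv> \<lambda>r ss. ss ! Suc (Suc k) \<noteq> None"

definition inc :: "nat \<Rightarrow> com list" where
  "inc k = [tape_op id (Suc (Suc k)) (\<lambda>s. (s, MoveRight)),
            tape_op id (Suc (Suc k)) (\<lambda>s. (Some True, Stay))]"

text \<open>The number in the control is updated in the same step, so that one decrement can also
  perform one multiplication modulo \<open>p\<close>.\<close>

definition dec :: "(nat \<Rightarrow> nat) \<Rightarrow> nat \<Rightarrow> com" where
  "dec \<rho> k = tape_op \<rho> (Suc (Suc k)) (\<lambda>s. (None, MoveLeft))"

definition put :: "nat \<Rightarrow> bool \<Rightarrow> com" where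
  "put k b = tape_op id k (\<lambda>s. (Some b, MoveRight))"

text \<open>Reading is destructive: the blanks left behind keep the left part equal to
  \<open>cell []\<close>, and the unread rest is again of the form \<open>inp\<close>.\<close>

definition erase :: "(nat \<Rightarrow> nat) \<Rightarrow> nat \<Rightarrow> com" where
  "erase \<rho> k = tape_op \<rho> k (\<lambda>s. (None, MoveRight))"

definition copy :: com where
  "copy = Act (\<lambda>r ss. (r, (stay ss)[0 := (None, MoveRight), 1 := (ss ! 0, MoveRight)]))"

text \<open>An increment of 0 carries a blank over to the left part, and a decrement leaves one in
  the right part; both are trailing blanks, which \<open>cell\<close> forgets.\<close>

lemma write_move_ctr:
  "write_move (Some True, Stay) (write_move (snd (ctr v) 0, MoveRight) (ctr v)) = ctr (Suc v)"
  "write_move (None, MoveLeft) (ctr (Suc v)) = ctr v"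
  by (cases v; simp add: ctr_def)+

lemma write_move_outp: "write_move (Some b, MoveRight) (outp u) = outp (u @ [b])"
  by (simp add: outp_def)

lemma write_move_inp: "write_move (None, MoveRight) (inp w) = inp (tl w)"
  by (cases w) (simp_all add: inp_def)

lemma head_ctr: "snd (ctr v) 0 = None \<longleftrightarrow> v = 0"
  by (simp add: ctr_def)

lemma head_inp: "snd (inp w) 0 = (case w of [] \<Rightarrow> None | b # _ \<Rightarrow> Some b)"
  by (cases w) (simp_all add: inp_def)

text \<open>This allows tape 0, once its input has been consumed, to be used as the output
  tape.\<close>

lemma inp_Nil: "inp [] = outp []"
  by (simp add: inp_def outp_def)

lemma runs_inc:
  assumes "k < 5"
  shows "runs (inc k) (r, st a b c) 2 (r, st a b (c(k := Suc (c k))))"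
proof -
  have "runs (inc k) (r, st a b c) (1 + 1)
    (id (id r), (st a b c)[Suc (Suc k) := write_move (Some True, Stay) (write_move (snd (ctr (c k)) 0, MoveRight) (ctr (c k)))])"
    unfolding inc_def
    by (rule runs_Cons[OF runs_tape_op], use assms in simp,
        rule runs_tape_op[THEN back_subst[of "runs _ _ _"]]) (use assms in simp_all)
  then show ?thesis using assms by (simp add: write_move_ctr numeral_2_eq_2)
qed

lemma runs_dec:
  assumes "k < 5" "c k = Suc v"
  shows "runs [dec \<rho> k] (r, st a b c) 1 (\<rho> r, st a b (c(k := v)))"
  using runs_tape_op[of "Suc (Suc k)" "st a b c" \<rho> "\<lambda>s. (None, MoveLeft)" r] assms
  by (simp add: dec_def write_move_ctr)

lemma runs_put: "runs [put 1 x] (r, st a (outp u) c) 1 (r, st a (outp (u @ [x])) c)"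
  using runs_tape_op[of 1 "st a (outp u) c" id "\<lambda>s. (Some x, MoveRight)" r]
  by (simp add: put_def write_move_outp)

lemma runs_put0: "runs [put 0 x] (r, st (outp u) b c) 1 (r, st (outp (u @ [x])) b c)"
  using runs_tape_op[of 0 "st (outp u) b c" id "\<lambda>s. (Some x, MoveRight)" r]
  by (simp add: put_def write_move_outp)

lemma runs_erase: "runs [erase \<rho> 0] (r, st (inp w) b c) 1 (\<rho> r, st (inp (tl w)) b c)"
  using runs_tape_op[of 0 "st (inp w) b c" \<rho> "\<lambda>s. (None, MoveRight)" r]
  by (simp add: erase_def write_move_inp)

lemma runs_erase1: "runs [erase \<rho> 1] (r, st a (inp w) c) 1 (\<rho> r, st a (inp (tl w)) c)"
  using runs_tape_op[of 1 "st a (inp w) c" \<rho> "\<lambda>s. (None, MoveRight)" r]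
  by (simp add: erase_def write_move_inp)

lemma runs_copy:
  "runs [copy] (r, st (inp (x # w)) (outp u) c) 1 (r, st (inp w) (outp (u @ [x])) c)"
  unfolding copy_def
  by (rule runs_Act[THEN back_subst[of "runs _ _ _"]], rule refl)
     (simp add: map2_stay_update2 write_move_inp write_move_outp head_inp)

lemma runs_puts:
  "runs (replicate n (put 1 x)) (r, st a (outp u) c) n (r, st a (outp (u @ replicate n x)) c)"
proof (induction n arbitrary: u)
  case 0
  then show ?case by (simp add: runs_Nil)
next
  case (Suc n)
  show ?case using runs_Cons[OF runs_put Suc] by simp
qed

text \<open>Counting down destroys counter \<open>k\<close>, so its value is parked in the scratch
  counter 2 while the ones are written, and the second loop moves it back.\<close>

definition emit :: "nat \<Rightarrow> nat \<Rightarrow> com list" where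
  "emit k a = [While (nonzero k) (dec id k # inc 2 @ replicate a (put 1 True)),
               While (nonzero 2) (dec id 2 # inc k)]"

lemma runs_emit:
  assumes k: "k < 5" "k \<noteq> 2" and c: "c 2 = 0"
  shows "runs (emit k a) (r, st x (outp u) c) (c k * (a + 8) + 2)
    (r, st x (outp (u @ replicate (a * c k) True)) c)"
proof -
  define n where "n = c k"
  define S where "S v = (r, st x (outp (u @ replicate (a * (n - v)) True)) (c(k := v, 2 := n - v)))" for v
  define u' where "u' = u @ replicate (a * n) True"
  define S' where "S' v = (r, st x (outp u') (c(k := n - v, 2 := v)))" for v
  have 1: "runs [While (nonzero k) (dec id k # inc 2 @ replicate a (put 1 True))] (S n)
      (n * ((1 + (2 + a)) + 1) + 1) (S 0)"
  proof (rule runs_While_count)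
    fix v assume v: "v < n"
    show "nonzero k (fst (S (Suc v))) (heads (snd (S (Suc v))))"
      using k by (simp add: S_def head_ctr)
    have e: "n - v = Suc (n - Suc v)" using v by simp
    have c': "(c(k := Suc v, 2 := n - Suc v))(k := v, 2 := Suc (n - Suc v)) = c(k := v, 2 := n - v)"
      unfolding e using k by (auto simp: fun_eq_iff)
    have u'': "(u @ replicate (a * (n - Suc v)) True) @ replicate a True
        = u @ replicate (a * (n - v)) True"
      unfolding e by (simp add: replicate_add[symmetric] add.commute)
    show "runs (dec id k # inc 2 @ replicate a (put 1 True)) (S (Suc v)) (1 + (2 + a)) (S v)"
    proof (rule runs_Cons)
      show "runs [dec id k] (S (Suc v)) 1 (id r,
          st x (outp (u @ replicate (a * (n - Suc v)) True)) ((c(k := Suc v, 2 := n - Suc v))(k := v)))"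
        unfolding S_def by (rule runs_dec) (use k in auto)
      have "runs (inc 2) (id r,
          st x (outp (u @ replicate (a * (n - Suc v)) True)) ((c(k := Suc v, 2 := n - Suc v))(k := v))) 2
          (r, st x (outp (u @ replicate (a * (n - Suc v)) True)) (c(k := v, 2 := n - v)))"
        using runs_inc[of 2 r x _ "(c(k := Suc v, 2 := n - Suc v))(k := v)"] k c' by simp
      moreover have "runs (replicate a (put 1 True))
          (r, st x (outp (u @ replicate (a * (n - Suc v)) True)) (c(k := v, 2 := n - v))) a (S v)"
        unfolding S_def u''[symmetric] by (rule runs_puts)
      ultimately show "runs (inc 2 @ replicate a (put 1 True)) (id r,
          st x (outp (u @ replicate (a * (n - Suc v)) True)) ((c(k := Suc v, 2 := n - Suc v))(k := v)))
          (2 + a) (S v)"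
        by (rule runs_append)
    qed
  next
    show "\<not> nonzero k (fst (S 0)) (heads (snd (S 0)))"
      using k by (simp add: S_def head_ctr)
  qed
  have 2: "runs [While (nonzero 2) (dec id 2 # inc k)] (S' n) (n * ((1 + 2) + 1) + 1) (S' 0)"
  proof (rule runs_While_count)
    fix v assume v: "v < n"
    show "nonzero 2 (fst (S' (Suc v))) (heads (snd (S' (Suc v))))"
      by (simp add: S'_def head_ctr)
    have e: "n - v = Suc (n - Suc v)" using v by simp
    have c': "(c(k := n - Suc v, 2 := Suc v))(2 := v, k := Suc (n - Suc v)) = c(k := n - v, 2 := v)"
      unfolding e using k by (auto simp: fun_eq_iff)
    show "runs (dec id 2 # inc k) (S' (Suc v)) (1 + 2) (S' v)"
    proof (rule runs_Cons)
      show "runs [dec id 2] (S' (Suc v)) 1 (id r,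
          st x (outp u') ((c(k := n - Suc v, 2 := Suc v))(2 := v)))"
        unfolding S'_def by (rule runs_dec) auto
      show "runs (inc k) (id r, st x (outp u') ((c(k := n - Suc v, 2 := Suc v))(2 := v))) 2 (S' v)"
        using runs_inc[of k r x "outp u'" "(c(k := n - Suc v, 2 := Suc v))(2 := v)"] k c'
        by (simp add: S'_def)
    qed
  next
    show "\<not> nonzero 2 (fst (S' 0)) (heads (snd (S' 0)))"
      by (simp add: S'_def head_ctr)
  qed
  have 3: "S 0 = S' n"
    by (simp add: S_def S'_def u'_def)
  have 4: "S n = (r, st x (outp u) c)" "S' 0 = (r, st x (outp u') c)"
    using k c by (auto simp: S_def S'_def n_def fun_eq_iff intro!: arg_cong[of _ _ "st _ _"])
  have "runs (emit k a) (r, st x (outp u) c)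
      ((n * ((1 + (2 + a)) + 1) + 1) + (n * ((1 + 2) + 1) + 1)) (r, st x (outp u') c)"
    unfolding emit_def by (rule runs_Cons[OF 1[unfolded 3 4] 2[unfolded 4]])
  then show ?thesis
    unfolding n_def u'_def by (rule runs_mono) (simp add: algebra_simps)
qed

text \<open>Such code appends \<open>f c\<close> and restores all counters. The constant
  \<open>C\<close> depends on the code alone; time and output are linear in any common bound
  \<open>N\<close> of the counters. Counter 2 has to be free for \<open>emit\<close>.\<close>

definition emits :: "com list \<Rightarrow> ((nat \<Rightarrow> nat) \<Rightarrow> bool list) \<Rightarrow> bool" where
  "emits cs f \<longleftrightarrow> (\<exists>C. \<forall>N c u x r. (\<forall>k. c k \<le> N) \<and> c 2 = 0 \<longrightarrow>
     length (f c) \<le> C * (N + 1) \<and>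
     runs cs (r, st x (outp u) c) (C * (N + 1)) (r, st x (outp (u @ f c)) c))"

lemma emits_Nil: "emits [] (\<lambda>c. [])"
  unfolding emits_def by (intro exI[of _ 0]) (simp add: runs_Nil)

lemma emits_append:
  assumes "emits cs f" "emits ds g"
  shows "emits (cs @ ds) (\<lambda>c. f c @ g c)"
proof -
  obtain C where C: "\<And>N c u x r. (\<forall>k. c k \<le> N) \<and> c 2 = 0 \<Longrightarrow>
     length (f c) \<le> C * (N + 1) \<and>
     runs cs (r, st x (outp u) c) (C * (N + 1)) (r, st x (outp (u @ f c)) c)"
    using assms(1) unfolding emits_def by blast
  obtain D where D: "\<And>N c u x r. (\<forall>k. c k \<le> N) \<and> c 2 = 0 \<Longrightarrow>
     length (g c) \<le> D * (N + 1) \<and>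
     runs ds (r, st x (outp u) c) (D * (N + 1)) (r, st x (outp (u @ g c)) c)"
    using assms(2) unfolding emits_def by blast
  show ?thesis
    unfolding emits_def
  proof (intro exI[of _ "C + D"] allI impI)
    fix N c u x and r :: nat assume *: "(\<forall>k. c k \<le> (N::nat)) \<and> c (2::nat) = 0"
    show "length (f c @ g c) \<le> (C + D) * (N + 1) \<and>
      runs (cs @ ds) (r, st x (outp u) c) ((C + D) * (N + 1)) (r, st x (outp (u @ f c @ g c)) c)"
      using C[OF *, of r x u] D[OF *, of r x "u @ f c"]
        runs_append[of cs "(r, st x (outp u) c)" "C * (N + 1)" "(r, st x (outp (u @ f c)) c)" ds
          "D * (N + 1)" "(r, st x (outp (u @ f c @ g c)) c)"]
      by (auto simp: algebra_simps)
  qed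
qed

lemma emits_put: "emits [put 1 b] (\<lambda>c. [b])"
  unfolding emits_def by (intro exI[of _ 1]) (auto intro: runs_mono[OF runs_put[unfolded One_nat_def]])

lemma emits_emit:
  assumes "k < 5" "k \<noteq> 2"
  shows "emits (emit k a) (\<lambda>c. replicate (a * c k) True)"
  unfolding emits_def
proof (intro exI[of _ "a + 10"] allI impI)
  fix N c u x and r :: nat assume *: "(\<forall>k. c k \<le> (N::nat)) \<and> c (2::nat) = 0"
  have "c k * (a + 8) + 2 \<le> (a + 10) * (N + 1)" "a * c k \<le> (a + 10) * (N + 1)"
    using mult_le_mono[of "c k" N "a + 8" "a + 8"] mult_le_mono[of "c k" N a a] *
    by (auto simp: algebra_simps intro: trans_le_add1)
  then show "length (replicate (a * c k) True) \<le> (a + 10) * (N + 1) \<and>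
      runs (emit k a) (r, st x (outp u) c) ((a + 10) * (N + 1))
        (r, st x (outp (u @ replicate (a * c k) True)) c)"
    using * assms by (auto intro: runs_mono[OF runs_emit])
qed

text \<open>In unary, a sum of multiples of counters is the concatenation of their blocks of ones,
  closed by a single \<open>False\<close>.\<close>

definition emit_num :: "(nat \<times> nat) list \<Rightarrow> com list" where
  "emit_num xs = concat (map (\<lambda>(k, a). emit k a) xs) @ [put 1 False]"

lemma emits_num:
  assumes "\<forall>(k, a) \<in> set xs. k < 5 \<and> k \<noteq> 2"
  shows "emits (emit_num xs) (\<lambda>c. unary (\<Sum>(k, a) \<leftarrow> xs. a * c k))"
proof -
  have "emits (concat (map (\<lambda>(k, a). emit k a) xs)) (\<lambda>c. replicate (\<Sum>(k, a) \<leftarrow> xs. a * c k) True)"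
    using assms
  proof (induction xs)
    case Nil
    then show ?case by (simp add: emits_Nil)
  next
    case (Cons ka xs)
    obtain k a where "ka = (k, a)" by (cases ka)
    then show ?case using Cons emits_append[OF emits_emit[of k a]]
      by (simp add: replicate_add)
  qed
  from emits_append[OF this emits_put[of False]] show ?thesis
    by (simp add: emit_num_def unary_def)
qed

lemma emits_concat_map:
  assumes "\<And>x. x \<in> set xs \<Longrightarrow> emits (P x) (f x)"
  shows "emits (concat (map P xs)) (\<lambda>c. concat (map (\<lambda>x. f x c) xs))"
  using assms
proof (induction xs)
  case Nil
  then show ?case by (simp add: emits_Nil)
next
  case (Cons y xs)
  then show ?case using emits_append[of "P y" "f y"] by simp
qed

text \<open>The decrement precedes the body, so the body sees the values from \<open>c k - 1\<close>
  down to 0. These are exactly the zero-based vertex indices, in reverse order, which does not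
  matter for a list of edges. Unlike in \<open>emit\<close>, the counter ends at 0.\<close>

lemma emits_loop:
  assumes "emits cs f" and k: "k < 5" "k \<noteq> 2"
  shows "\<exists>C. \<forall>N c u x r. (\<forall>k. c k \<le> N) \<and> c 2 = 0 \<longrightarrow>
     length (concat (map (\<lambda>i. f (c(k := i))) (rev [0..<c k]))) \<le> C * (N + 1)^2 \<and>
     runs [While (nonzero k) (dec id k # cs)] (r, st x (outp u) c) (C * (N + 1)^2)
       (r, st x (outp (u @ concat (map (\<lambda>i. f (c(k := i))) (rev [0..<c k])))) (c(k := 0)))"
proof -
  obtain C where C: "\<And>N c u x r. (\<forall>k. c k \<le> N) \<and> c 2 = 0 \<Longrightarrow>
     length (f c) \<le> C * (N + 1) \<and>
     runs cs (r, st x (outp u) c) (C * (N + 1)) (r, st x (outp (u @ f c)) c)"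
    using assms(1) unfolding emits_def by blast
  show ?thesis
  \<comment> \<open>At most \<open>N\<close> iterations of cost \<open>C * (N + 1) + 2\<close> and
    one failing test fit below \<open>(C + 3) * (N + 1)^2\<close>.\<close>
  proof (intro exI[of _ "C + 3"] allI impI)
    fix N c u x and r :: nat assume *: "(\<forall>k. c k \<le> (N::nat)) \<and> c (2::nat) = 0"
    define n where "n = c k"
    have n: "n \<le> N" using * by (simp add: n_def)
    define out where "out v = concat (map (\<lambda>i. f (c(k := i))) (rev [v..<n]))" for v
    define S where "S v = (r, st x (outp (u @ out v)) (c(k := v)))" for v
    have ok: "(\<forall>j. (c(k := v)) j \<le> N) \<and> (c(k := v)) 2 = 0" if "v < n" for v
      using * k n that by auto
    have out_Suc: "out v = out (Suc v) @ f (c(k := v))" if "v < n" for v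
      using that by (simp add: out_def upt_conv_Cons)
    have len: "length (out v) \<le> (n - v) * (C * (N + 1))" if "v \<le> n" for v
      using that
    proof (induction rule: inc_induct)
      case base
      then show ?case by (simp add: out_def)
    next
      case (step v)
      have "n - v = Suc (n - Suc v)" using step by simp
      then show ?case using step C[of "c(k := v)" N] ok[of v] out_Suc[of v] by fastforce
    qed
    have "runs [While (nonzero k) (dec id k # cs)] (S n) (n * ((1 + C * (N + 1)) + 1) + 1) (S 0)"
    proof (rule runs_While_count)
      fix v assume v: "v < n"
      show "nonzero k (fst (S (Suc v))) (heads (snd (S (Suc v))))"
        using k by (simp add: S_def head_ctr)
      show "runs (dec id k # cs) (S (Suc v)) (1 + C * (N + 1)) (S v)"
      proof (rule runs_Cons)
        show "runs [dec id k] (S (Suc v)) 1 (id r, st x (outp (u @ out (Suc v))) ((c(k := Suc v))(k := v)))"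
          unfolding S_def by (rule runs_dec) (use k in auto)
        show "runs cs (id r, st x (outp (u @ out (Suc v))) ((c(k := Suc v))(k := v))) (C * (N + 1)) (S v)"
          using C[of "c(k := v)" N r x "u @ out (Suc v)"] ok[OF v] by (simp add: S_def out_Suc[OF v])
      qed
    next
      show "\<not> nonzero k (fst (S 0)) (heads (snd (S 0)))"
        using k by (simp add: S_def head_ctr)
    qed
    moreover have "n * ((1 + C * (N + 1)) + 1) + 1 \<le> (C + 3) * (N + 1)^2"
    proof -
      have "n * ((1 + C * (N + 1)) + 1) + 1 \<le> N * ((1 + C * (N + 1)) + 1) + 1"
        using n by (intro add_mono mult_le_mono) simp_all
      also have "\<dots> \<le> (C + 3) * (N + 1)^2"
        by (simp add: power2_eq_square algebra_simps)
      finally show ?thesis .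
    qed
    ultimately have "runs [While (nonzero k) (dec id k # cs)] (S n) ((C + 3) * (N + 1)^2) (S 0)"
      by (rule runs_mono)
    moreover have "S n = (r, st x (outp u) c)"
      by (simp add: S_def out_def n_def)
    moreover have "length (out 0) \<le> (C + 3) * (N + 1)^2"
    proof -
      have "length (out 0) \<le> n * (C * (N + 1))" using len[of 0] by simp
      also have "\<dots> \<le> (N + 1) * ((C + 3) * (N + 1))"
        using n by (intro mult_le_mono) auto
      finally show ?thesis by (simp only: power2_eq_square ac_simps)
    qed
    ultimately show "length (concat (map (\<lambda>i. f (c(k := i))) (rev [0..<c k]))) \<le> (C + 3) * (N + 1)^2 \<and>
     runs [While (nonzero k) (dec id k # cs)] (r, st x (outp u) c) ((C + 3) * (N + 1)^2)
       (r, st x (outp (u @ concat (map (\<lambda>i. f (c(k := i))) (rev [0..<c k])))) (c(k := 0)))"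
      by (simp add: S_def out_def n_def)
  qed
qed

section \<open>Reading, copying and rewinding words\<close>

abbreviation reads_one :: "nat \<Rightarrow> nat \<Rightarrow> bool option list \<Rightarrow> bool" where
  "reads_one k \<equiv> \<lambda>r ss. ss ! k = Some True"

text \<open>Two counters receive the value because it is needed twice: as a coefficient that
  survives to the end and as a loop variable that is used up. The last \<open>erase\<close> consumes
  the closing \<open>False\<close>.\<close>

definition read_num :: "nat \<Rightarrow> nat \<Rightarrow> com list" where
  "read_num i j = [While (reads_one 0) (erase id 0 # inc i @ inc j), erase id 0]"

lemma runs_read_num:
  assumes "i < 5" "j < 5" "i \<noteq> j" "c i = 0" "c j = 0"
  shows "runs (read_num i j) (r, st (inp (unary n @ w)) b c) (6 * n + 2)
    (r, st (inp w) b (c(i := n, j := n)))"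
proof -
  define S where "S v = (r, st (inp (unary v @ w)) b (c(i := n - v, j := n - v)))" for v
  have "runs [While (reads_one 0) (erase id 0 # inc i @ inc j)] (S n) (n * ((1 + (2 + 2)) + 1) + 1) (S 0)"
  proof (rule runs_While_count)
    fix v assume v: "v < n"
    show "reads_one 0 (fst (S (Suc v))) (heads (snd (S (Suc v))))"
      by (simp add: S_def unary_def head_inp)
    let ?c = "c(i := n - Suc v, j := n - Suc v)"
    have e: "n - v = Suc (n - Suc v)" using v by simp
    have c': "?c(i := Suc (?c i), j := Suc ((?c(i := Suc (?c i))) j)) = c(i := n - v, j := n - v)"
      unfolding e using assms by (auto simp: fun_eq_iff)
    show "runs (erase id 0 # inc i @ inc j) (S (Suc v)) (1 + (2 + 2)) (S v)"
    proof (rule runs_Cons)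
      show "runs [erase id 0] (S (Suc v)) 1 (r, st (inp (unary v @ w)) b ?c)"
        using runs_erase[of id r "unary (Suc v) @ w" b ?c] by (simp add: S_def unary_def)
      show "runs (inc i @ inc j) (r, st (inp (unary v @ w)) b ?c) (2 + 2) (S v)"
        unfolding S_def c'[symmetric] using assms by (intro runs_append[OF runs_inc runs_inc])
    qed
  next
    show "\<not> reads_one 0 (fst (S 0)) (heads (snd (S 0)))"
      by (simp add: S_def unary_def head_inp)
  qed
  moreover have "runs [erase id 0] (S 0) 1 (r, st (inp w) b (c(i := n, j := n)))"
    using runs_erase[of id r "unary 0 @ w" b "c(i := n, j := n)"] by (simp add: S_def unary_def)
  ultimately have "runs (read_num i j) (S n) ((n * ((1 + (2 + 2)) + 1) + 1) + 1)
      (r, st (inp w) b (c(i := n, j := n)))"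
    unfolding read_num_def by (rule runs_Cons)
  moreover have "S n = (r, st (inp (unary n @ w)) b c)"
    using assms by (auto simp: S_def fun_eq_iff intro!: arg_cong[of _ _ "st _ _"])
  ultimately show ?thesis
    by (auto elim: runs_mono)
qed

definition copy_rest :: "com list" where
  "copy_rest = [While (\<lambda>r ss. ss ! 0 \<noteq> None) [copy]]"

lemma runs_copy_rest:
  "runs copy_rest (r, st (inp w) (outp u) c) (2 * length w + 1) (r, st (inp []) (outp (u @ w)) c)"
proof (induction w arbitrary: u)
  case Nil
  show ?case
    unfolding copy_rest_def by (rule runs_mono[OF runs_While_False[THEN back_subst[of "runs _ _ _"]]])
      (simp_all add: head_inp)
next
  case (Cons x w)
  have "runs copy_rest (r, st (inp (x # w)) (outp u) c) (Suc (1 + (2 * length w + 1)))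
      (r, st (inp []) (outp ((u @ [x]) @ w)) c)"
    unfolding copy_rest_def
    by (rule runs_While_True, simp add: head_inp)
      (rule runs_append[OF runs_copy Cons[unfolded copy_rest_def]])
  then show ?case by (rule runs_mono[THEN back_subst[of "runs _ _ _"]]) simp_all
qed

text \<open>The first move goes from behind the word onto its last bit. The loop then stops on the
  blank in front of the word, one cell too far, and the last move corrects this.\<close>

definition rewind :: "nat \<Rightarrow> com list" where
  "rewind k = [tape_op id k (\<lambda>s. (s, MoveLeft)),
    While (\<lambda>r ss. ss ! k \<noteq> None) [tape_op id k (\<lambda>s. (s, MoveLeft))],
    tape_op id k (\<lambda>s. (s, MoveRight))]"

lemma runs_rewind_loop:
  assumes "k < length ts" "ts ! k = (cell (map Some zs), cell (map Some (y # ys)))"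
  shows "runs [While (\<lambda>r ss. ss ! k \<noteq> None) [tape_op id k (\<lambda>s. (s, MoveLeft))]] (r, ts)
    (2 * length zs + 3) (r, ts[k := (cell [], cell (None # map Some (rev zs @ y # ys)))])"
  using assms
proof (induction zs arbitrary: ts y ys)
  case Nil
  let ?ts = "ts[k := (cell [], cell (None # map Some (y # ys)))]"
  have "runs [tape_op id k (\<lambda>s. (s, MoveLeft))] (r, ts) 1 (r, ?ts)"
    using runs_tape_op[of k ts id "\<lambda>s. (s, MoveLeft)" r] Nil by simp
  moreover have "runs [While (\<lambda>r ss. ss ! k \<noteq> None) [tape_op id k (\<lambda>s. (s, MoveLeft))]] (r, ?ts) 1 (r, ?ts)"
    by (rule runs_While_False) (use Nil in simp)
  ultimately have "runs [While (\<lambda>r ss. ss ! k \<noteq> None) [tape_op id k (\<lambda>s. (s, MoveLeft))]] (r, ts)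
      (Suc (1 + 1)) (r, ?ts)"
    by (intro runs_While_True runs_append) (use Nil in simp_all)
  then show ?case by (rule runs_mono[THEN back_subst[of "runs _ _ _"]]) simp_all
next
  case (Cons z zs)
  let ?ts = "ts[k := (cell (map Some zs), cell (map Some (z # y # ys)))]"
  have "runs [tape_op id k (\<lambda>s. (s, MoveLeft))] (r, ts) 1 (r, ?ts)"
    using runs_tape_op[of k ts id "\<lambda>s. (s, MoveLeft)" r] Cons.prems by simp
  moreover have "runs [While (\<lambda>r ss. ss ! k \<noteq> None) [tape_op id k (\<lambda>s. (s, MoveLeft))]] (r, ?ts)
      (2 * length zs + 3) (r, ?ts[k := (cell [], cell (None # map Some (rev zs @ z # y # ys)))])"
    by (rule Cons.IH) (use Cons.prems in simp_all)
  ultimately have "runs [While (\<lambda>r ss. ss ! k \<noteq> None) [tape_op id k (\<lambda>s. (s, MoveLeft))]] (r, ts)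
      (Suc (1 + (2 * length zs + 3))) (r, ?ts[k := (cell [], cell (None # map Some (rev zs @ z # y # ys)))])"
    by (intro runs_While_True runs_append) (use Cons.prems in simp_all)
  then show ?case by (rule runs_mono[THEN back_subst[of "runs _ _ _"]]) simp_all
qed

lemma runs_rewind:
  assumes "k < length ts" "ts ! k = outp u" "u \<noteq> []"
  shows "runs (rewind k) (r, ts) (2 * length u + 5) (r, ts[k := inp u])"
proof -
  obtain zs y where u: "u = rev zs @ [y]"
    using assms(3) by (metis rev_exhaust rev_rev_ident)
  let ?t1 = "ts[k := (cell (map Some zs), cell (map Some [y]))]"
  let ?t2 = "?t1[k := (cell [], cell (None # map Some (rev zs @ [y])))]"
  have 1: "runs [tape_op id k (\<lambda>s. (s, MoveLeft))] (r, ts) 1 (r, ?t1)"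
    using runs_tape_op[of k ts id "\<lambda>s. (s, MoveLeft)" r] assms by (simp add: u outp_def)
  have 2: "runs [While (\<lambda>r ss. ss ! k \<noteq> None) [tape_op id k (\<lambda>s. (s, MoveLeft))]] (r, ?t1)
      (2 * length zs + 3) (r, ?t2)"
    by (rule runs_rewind_loop) (use assms in simp_all)
  have 3: "runs [tape_op id k (\<lambda>s. (s, MoveRight))] (r, ?t2) 1 (r, ts[k := inp u])"
    using runs_tape_op[of k ?t2 id "\<lambda>s. (s, MoveRight)" r] assms by (simp add: u inp_def)
  have "runs (rewind k) (r, ts) (1 + ((2 * length zs + 3) + 1)) (r, ts[k := inp u])"
    unfolding rewind_def by (rule runs_Cons[OF 1 runs_Cons[OF 2 3]])
  then show ?thesis by (rule runs_mono) (simp add: u)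
qed


definition edge_word :: "nat \<times> nat \<Rightarrow> bool list" where
  "edge_word = (\<lambda>(i, j). unary i @ unary j)"

text \<open>Counters 0 and 1 hold the numbers \<open>n\<close> and \<open>m\<close> of left and right vertices of the input,
  counter 2 is scratch space, and counters 3 and 4 run over the left and right vertices to which
  a gadget is attached.\<close>

definition write_query ::
    "nat \<Rightarrow> nat \<Rightarrow> nat \<Rightarrow> nat \<Rightarrow> (nat \<times> nat) list \<Rightarrow> (nat \<times> nat) list \<Rightarrow> com list" where
  "write_query a1 a2 b1 b2 EL ER =
     read_num 0 3 @ read_num 1 4 @
     (emit_num [(0, a1), (1, a2)] @ emit_num [(1, b2), (0, b1)]) @
     copy_rest @
     [While (nonzero 3) (dec id 3 # concat (map (\<lambda>(a, b).
        emit_num [(0, a), (3, 1)] @ emit_num [(1, b2), (0, b), (3, 1)]) EL))] @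
     [While (nonzero 4) (dec id 4 # concat (map (\<lambda>(a, b).
        emit_num [(0, a1), (1, a), (4, 1)] @ emit_num [(1, b), (4, 1)]) ER))] @
     rewind 1"

text \<open>Vertex \<open>a\<close> of the gadget attached to vertex \<open>i\<close> gets an index of the form \<open>a * n + i\<close> plus an
  offset. As \<open>x\<close> and \<open>y\<close> are numbered 0, the edges of the original graph keep their indices
  and can be copied verbatim.\<close>

definition query_edges ::
    "nat \<Rightarrow> nat \<Rightarrow> (nat \<times> nat) list \<Rightarrow> (nat \<times> nat) list \<Rightarrow> nat \<Rightarrow> nat \<Rightarrow> (nat \<times> nat) list \<Rightarrow>
     (nat \<times> nat) list" where
  "query_edges a1 b2 EL ER n m es = es @
     concat (map (\<lambda>i. map (\<lambda>(a, b). (a * n + i, b2 * m + b * n + i)) EL) (rev [0..<n])) @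
     concat (map (\<lambda>j. map (\<lambda>(a, b). (a1 * n + a * m + j, b * m + j)) ER) (rev [0..<m]))"

lemma length_edge_word_le:
  "n + m \<le> length (encode_instance n m es)"
  "length (concat (map edge_word es)) \<le> length (encode_instance n m es)"
  by (simp_all add: encode_instance_def unary_def edge_word_def)

lemma concat_concat: "concat (concat xss) = concat (map concat xss)"
  by (induction xss) auto

text \<open>Time is quadratic because at most \<open>N\<close> rounds of each gadget loop write
  linearly many bits each. Counters 0 and 1 still hold \<open>n\<close> and \<open>m\<close> at the
  end; the second program needs them to count its multiplications.\<close>

lemma runs_write_query:
  "\<exists>C. \<forall>n m es. runs (write_query a1 a2 b1 b2 EL ER)
     (0, st (inp (encode_instance n m es)) (outp []) (\<lambda>_. 0))
     (C * (length (encode_instance n m es) + 1)^2)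
     (0, st (inp []) (inp (encode_instance (a1 * n + a2 * m) (b2 * m + b1 * n)
            (query_edges a1 b2 EL ER n m es))) ((\<lambda>_. 0)(0 := n, 1 := m)))"
proof -
  define hdr where "hdr c = unary (a1 * c 0 + a2 * c 1) @ unary (b2 * c 1 + b1 * c 0)"
    for c :: "nat \<Rightarrow> nat"
  define fL where "fL ab c = unary (fst ab * c 0 + c 3) @ unary (b2 * c 1 + snd ab * c 0 + c 3)"
    for ab :: "nat \<times> nat" and c :: "nat \<Rightarrow> nat"
  define outL where "outL c = concat (map (\<lambda>ab. fL ab c) EL)" for c
  define fR where "fR ab c = unary (a1 * c 0 + fst ab * c 1 + c 4) @ unary (snd ab * c 1 + c 4)"
    for ab :: "nat \<times> nat" and c :: "nat \<Rightarrow> nat"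
  define outR where "outR c = concat (map (\<lambda>ab. fR ab c) ER)" for c
  define bodyL where "bodyL = concat (map (\<lambda>(a, b).
        emit_num [(0, a), (3, 1)] @ emit_num [(1, b2), (0, b), (3, 1)]) EL)"
  define bodyR where "bodyR = concat (map (\<lambda>(a, b).
        emit_num [(0, a1), (1, a), (4, 1)] @ emit_num [(1, b), (4, 1)]) ER)"
  have "emits (emit_num [(0, a1), (1, a2)] @ emit_num [(1, b2), (0, b1)]) hdr"
    using emits_append[OF emits_num[of "[(0, a1), (1, a2)]"] emits_num[of "[(1, b2), (0, b1)]"]]
    by (simp add: hdr_def[abs_def])
  then obtain C1 where C1: "\<And>N c u x r. (\<forall>k. c k \<le> N) \<and> c 2 = 0 \<Longrightarrow>
     length (hdr c) \<le> C1 * (N + 1) \<and>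
     runs (emit_num [(0, a1), (1, a2)] @ emit_num [(1, b2), (0, b1)])
       (r, st x (outp u) c) (C1 * (N + 1)) (r, st x (outp (u @ hdr c)) c)"
    unfolding emits_def by blast
  have lt: "(3::nat) < 5" "(3::nat) \<noteq> 2" "(4::nat) < 5" "(4::nat) \<noteq> 2" by simp_all
  have "emits bodyL outL"
    unfolding bodyL_def outL_def[abs_def]
  proof (rule emits_concat_map)
    fix ab
    show "emits (case ab of (a, b) \<Rightarrow> emit_num [(0, a), (3, 1)] @ emit_num [(1, b2), (0, b), (3, 1)]) (fL ab)"
      using emits_append[OF emits_num[of "[(0, fst ab), (3, 1)]"] emits_num[of "[(1, b2), (0, snd ab), (3, 1)]"]]
      by (simp add: fL_def[abs_def] case_prod_beta add.assoc)
  qed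
  from emits_loop[OF this lt(1,2)] obtain C2 where C2: "\<And>N c u x r. (\<forall>k. c k \<le> N) \<and> c 2 = 0 \<Longrightarrow>
     length (concat (map (\<lambda>i. outL (c(3 := i))) (rev [0..<c 3]))) \<le> C2 * (N + 1)^2 \<and>
     runs [While (nonzero 3) (dec id 3 # bodyL)] (r, st x (outp u) c) (C2 * (N + 1)^2)
       (r, st x (outp (u @ concat (map (\<lambda>i. outL (c(3 := i))) (rev [0..<c 3])))) (c(3 := 0)))"
    by blast
  have "emits bodyR outR"
    unfolding bodyR_def outR_def[abs_def]
  proof (rule emits_concat_map)
    fix ab
    show "emits (case ab of (a, b) \<Rightarrow> emit_num [(0, a1), (1, a), (4, 1)] @ emit_num [(1, b), (4, 1)]) (fR ab)"
      using emits_append[OF emits_num[of "[(0, a1), (1, fst ab), (4, 1)]"] emits_num[of "[(1, snd ab), (4, 1)]"]]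
      by (simp add: fR_def[abs_def] case_prod_beta add.assoc)
  qed
  from emits_loop[OF this lt(3,4)] obtain C3 where C3: "\<And>N c u x r. (\<forall>k. c k \<le> N) \<and> c 2 = 0 \<Longrightarrow>
     length (concat (map (\<lambda>i. outR (c(4 := i))) (rev [0..<c 4]))) \<le> C3 * (N + 1)^2 \<and>
     runs [While (nonzero 4) (dec id 4 # bodyR)] (r, st x (outp u) c) (C3 * (N + 1)^2)
       (r, st x (outp (u @ concat (map (\<lambda>i. outR (c(4 := i))) (rev [0..<c 4])))) (c(4 := 0)))"
    by blast
  show ?thesis
  \<comment> \<open>Each of \<open>C1\<close>, \<open>C2\<close>, \<open>C3\<close> is paid once for
    writing and twice for rewinding over what was written; 24 absorbs the linear terms.\<close>
  proof (intro exI[of _ "3 * C1 + 3 * C2 + 3 * C3 + 24"] allI)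
    fix n m es
    define w where "w = encode_instance n m es"
    define N where "N = length w"
    define ew where "ew = concat (map edge_word es)"
    define c where "c = ((\<lambda>_. 0)(0 := n, 3 := n, 1 := m, 4 := m) :: nat \<Rightarrow> nat)"
    define c' where "c' = c(3 := 0)"
    have nm: "n + m \<le> N" and ew: "length ew \<le> N"
      using length_edge_word_le[where n = n and m = m and es = es]
      by (simp_all add: N_def w_def ew_def)
    have w: "w = unary n @ unary m @ ew"
      by (simp add: w_def encode_instance_def ew_def edge_word_def)
    have c: "(\<forall>k. c k \<le> N) \<and> c 2 = 0" "(\<forall>k. c' k \<le> N) \<and> c' 2 = 0"
      using nm by (auto simp: c_def c'_def)
    have c3: "c 3 = n" "c' 4 = m"
      by (simp_all add: c_def c'_def)
    define uL where "uL = concat (map (\<lambda>i. outL (c(3 := i))) (rev [0..<n]))"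
    define uR where "uR = concat (map (\<lambda>i. outR (c'(4 := i))) (rev [0..<m]))"
    define u where "u = hdr c @ ew @ uL @ uR"
    have 1: "runs (read_num 0 3) (0, st (inp w) (outp []) (\<lambda>_. 0)) (6 * n + 2)
        (0, st (inp (unary m @ ew)) (outp []) ((\<lambda>_. 0)(0 := n, 3 := n)))"
      unfolding w by (rule runs_read_num) auto
    have 2: "runs (read_num 1 4) (0, st (inp (unary m @ ew)) (outp []) ((\<lambda>_. 0)(0 := n, 3 := n))) (6 * m + 2)
        (0, st (inp ew) (outp []) c)"
      unfolding c_def by (rule runs_read_num) auto
    have 3: "runs (emit_num [(0, a1), (1, a2)] @ emit_num [(1, b2), (0, b1)])
        (0, st (inp ew) (outp []) c) (C1 * (N + 1)) (0, st (inp ew) (outp (hdr c)) c)"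
      using C1[of c N 0 "inp ew" "[]"] c(1) by simp
    have 4: "runs copy_rest (0, st (inp ew) (outp (hdr c)) c) (2 * length ew + 1)
        (0, st (inp []) (outp (hdr c @ ew)) c)"
      by (rule runs_copy_rest)
    have 5: "runs [While (nonzero 3) (dec id 3 # bodyL)] (0, st (inp []) (outp (hdr c @ ew)) c)
        (C2 * (N + 1)^2) (0, st (inp []) (outp ((hdr c @ ew) @ uL)) c')"
      using C2[of c N 0 "inp []" "hdr c @ ew"] c(1) by (simp add: uL_def c3 c'_def)
    have 6: "runs [While (nonzero 4) (dec id 4 # bodyR)] (0, st (inp []) (outp ((hdr c @ ew) @ uL)) c')
        (C3 * (N + 1)^2) (0, st (inp []) (outp u) (c'(4 := 0)))"
      using C3[of c' N 0 "inp []" "(hdr c @ ew) @ uL"] c(2) by (simp add: uR_def c3 u_def)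
    have 7: "runs (rewind 1) (0, st (inp []) (outp u) (c'(4 := 0))) (2 * length u + 5)
        (0, st (inp []) (inp u) (c'(4 := 0)))"
      using runs_rewind[of 1 "st (inp []) (outp u) (c'(4 := 0))" u 0]
      by (simp add: u_def hdr_def unary_def)
    have run: "runs (write_query a1 a2 b1 b2 EL ER) (0, st (inp w) (outp []) (\<lambda>_. 0))
        ((6 * n + 2) + ((6 * m + 2) + (C1 * (N + 1) + ((2 * length ew + 1) + (C2 * (N + 1)^2 +
         (C3 * (N + 1)^2 + (2 * length u + 5)))))))
        (0, st (inp []) (inp u) (c'(4 := 0)))"
      unfolding write_query_def bodyL_def[symmetric] bodyR_def[symmetric]
      by (rule runs_append[OF 1 runs_append[OF 2 runs_append[OF 3 runs_append[OF 4
            runs_append[OF 5 runs_append[OF 6 7]]]]]])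
    have len: "length u \<le> C1 * (N + 1) + N + C2 * (N + 1)^2 + C3 * (N + 1)^2"
    proof -
      have "length (hdr c) \<le> C1 * (N + 1)" "length uL \<le> C2 * (N + 1)^2" "length uR \<le> C3 * (N + 1)^2"
        using C1[of c N 0 "inp []" "[]"] C2[of c N 0 "inp []" "[]"] C3[of c' N 0 "inp []" "[]"] c
        by (simp_all add: uL_def uR_def c3)
      then show ?thesis using ew unfolding u_def length_append by linarith
    qed
    have N1: "C1 * (N + 1) \<le> C1 * (N + 1)^2" "N + 1 \<le> (N + 1)^2"
      by (simp_all add: power2_eq_square)
    have bound: "(6 * n + 2) + ((6 * m + 2) + (C1 * (N + 1) + ((2 * length ew + 1) + (C2 * (N + 1)^2 +
         (C3 * (N + 1)^2 + (2 * length u + 5)))))) \<le> (3 * C1 + 3 * C2 + 3 * C3 + 24) * (N + 1)^2"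
    proof -
      have arith: "(6 * n + 2) + ((6 * m + 2) + (X + ((2 * length ew + 1) + (Y + (Z + (2 * L + 5))))))
          \<le> 3 * X + 3 * Y + 3 * Z + 10 * (N + 1)" if "L \<le> X + N + Y + Z" for L X Y Z
        using that nm ew by simp
      have "(6 * n + 2) + ((6 * m + 2) + (C1 * (N + 1) + ((2 * length ew + 1) + (C2 * (N + 1)^2 +
         (C3 * (N + 1)^2 + (2 * length u + 5))))))
        \<le> 3 * (C1 * (N + 1)) + 3 * (C2 * (N + 1)^2) + 3 * (C3 * (N + 1)^2) + 10 * (N + 1)"
        using arith[OF len] .
      also have "\<dots> \<le> 3 * (C1 * (N + 1)^2) + 3 * (C2 * (N + 1)^2) + 3 * (C3 * (N + 1)^2) + 24 * (N + 1)^2"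
        using N1 by (intro add_mono mult_le_mono2) (simp_all add: le_trans[OF _ mult_le_mono])
      finally show ?thesis by (simp add: algebra_simps)
    qed
    have cc: "c'(4 := 0) = (\<lambda>_. 0)(0 := n, 1 := m)"
      by (auto simp: c_def c'_def fun_eq_iff)
    have uu: "u = encode_instance (a1 * n + a2 * m) (b2 * m + b1 * n) (query_edges a1 b2 EL ER n m es)"
      by (simp add: u_def hdr_def uL_def uR_def ew_def outL_def outR_def fL_def fR_def c_def c'_def
          encode_instance_def query_edges_def edge_word_def map_concat comp_def case_prod_beta concat_concat)
    show "runs (write_query a1 a2 b1 b2 EL ER)
     (0, st (inp (encode_instance n m es)) (outp []) (\<lambda>_. 0))
     ((3 * C1 + 3 * C2 + 3 * C3 + 24) * (length (encode_instance n m es) + 1)^2)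
     (0, st (inp []) (inp (encode_instance (a1 * n + a2 * m) (b2 * m + b1 * n)
            (query_edges a1 b2 EL ER n m es))) ((\<lambda>_. 0)(0 := n, 1 := m)))"
      using runs_mono[OF run bound] unfolding cc uu N_def w_def .
  qed
qed

text \<open>The finite control holds a residue modulo \<open>p\<close>: the answer of the oracle is read into it,
  multiplied by \<open>c\<close> and \<open>d\<close> once for every left and right vertex, and written out in unary.\<close>

definition write_answer :: "nat \<Rightarrow> nat \<Rightarrow> nat \<Rightarrow> com list" where
  "write_answer p c d =
     [While (reads_one 1) [erase (\<lambda>r. Suc r mod p) 1],
      While (nonzero 0) [dec (\<lambda>r. r * c mod p) 0],
      While (nonzero 1) [dec (\<lambda>r. r * d mod p) 1],
      While (\<lambda>r ss. r \<noteq> 0) [tape_op (\<lambda>r. r - 1) 0 (\<lambda>s. (Some True, MoveRight))],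
      put 0 False] @ rewind 0"

lemma runs_multiply:
  assumes "k < 5"
  shows "runs [While (nonzero k) [dec (\<lambda>r. r * z mod p) k]] (r mod p, st a b c)
    (2 * c k + 1) (r * z ^ c k mod p, st a b (c(k := 0)))"
proof -
  define S where "S v = (r * z ^ (c k - v) mod p, st a b (c(k := v)))" for v
  have "runs [While (nonzero k) [dec (\<lambda>r. r * z mod p) k]] (S (c k)) (c k * (1 + 1) + 1) (S 0)"
  proof (rule runs_While_count)
    fix v assume "v < c k"
    then have e: "c k - v = Suc (c k - Suc v)" by simp
    show "nonzero k (fst (S (Suc v))) (heads (snd (S (Suc v))))"
      using assms by (simp add: S_def head_ctr)
    have "r * z ^ (c k - Suc v) mod p * z mod p = r * z ^ (c k - v) mod p"
      unfolding e by (simp add: mod_simps ac_simps)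
    then show "runs [dec (\<lambda>r. r * z mod p) k] (S (Suc v)) 1 (S v)"
      using runs_dec[of k "c(k := Suc v)" v "\<lambda>r. r * z mod p" "r * z ^ (c k - Suc v) mod p" a b] assms
      by (simp add: S_def)
  next
    show "\<not> nonzero k (fst (S 0)) (heads (snd (S 0)))"
      using assms by (simp add: S_def head_ctr)
  qed
  then show ?thesis by (simp add: S_def mult_2)
qed

lemma runs_write_answer:
  assumes p: "r < p"
  shows "runs (write_answer p c d) (0, st (outp []) (inp (unary r)) ((\<lambda>_. 0)(0 := n, 1 := m)))
    (2 * n + 2 * m + 6 * p + 12)
    (0, st (inp (unary (r * c ^ n * d ^ m mod p))) (inp [False]) (\<lambda>_. 0))"
proof -
  let ?c = "((\<lambda>_. 0)(0 := n, 1 := m)) :: nat \<Rightarrow> nat"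
  define s where "s = r * c ^ n * d ^ m mod p"
  have s: "s < p" using p by (simp add: s_def)
  \<comment> \<open>\<open>r - v\<close> ones have been read so far. The reduction changes nothing
    as \<open>r < p\<close>, but the command has to contain it to keep the number in the control
    below \<open>p\<close>.\<close>
  define S where "S v = ((r - v) mod p, st (outp []) (inp (unary v)) ?c)" for v
  have "runs [While (reads_one 1) [erase (\<lambda>r. Suc r mod p) 1]] (S r) (r * (1 + 1) + 1) (S 0)"
  proof (rule runs_While_count)
    fix v assume "v < r"
    then have e: "r - v = Suc (r - Suc v)" by simp
    show "reads_one 1 (fst (S (Suc v))) (heads (snd (S (Suc v))))"
      by (simp add: S_def head_inp unary_def)
    show "runs [erase (\<lambda>r. Suc r mod p) 1] (S (Suc v)) 1 (S v)"
      using runs_erase1[of "\<lambda>r. Suc r mod p" "(r - Suc v) mod p" "outp []" "unary (Suc v)" ?c]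
      unfolding S_def e by (simp add: mod_Suc_eq unary_def)
  next
    show "\<not> reads_one 1 (fst (S 0)) (heads (snd (S 0)))"
      by (simp add: S_def head_inp unary_def)
  qed
  then have 1: "runs [While (reads_one 1) [erase (\<lambda>r. Suc r mod p) 1]]
      (0, st (outp []) (inp (unary r)) ?c) (2 * r + 1) (r mod p, st (outp []) (inp [False]) ?c)"
    by (simp add: S_def unary_def mult_2)
  have 2: "runs [While (nonzero 0) [dec (\<lambda>r. r * c mod p) 0]] (r mod p, st (outp []) (inp [False]) ?c)
      (2 * n + 1) (r * c ^ n mod p, st (outp []) (inp [False]) (?c(0 := 0)))"
    using runs_multiply[of 0 c p r "outp []" "inp [False]" ?c] by simp
  have 3: "runs [While (nonzero 1) [dec (\<lambda>r. r * d mod p) 1]]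
      (r * c ^ n mod p, st (outp []) (inp [False]) (?c(0 := 0))) (2 * m + 1)
      (s, st (outp []) (inp [False]) (\<lambda>_. 0))"
  proof -
    have e: "?c(0 := 0, 1 := 0) = (\<lambda>_. 0)" by auto
    show ?thesis
      using runs_multiply[of 1 d p "r * c ^ n" "outp []" "inp [False]" "?c(0 := 0)"] unfolding e
      by (simp add: s_def)
  qed
  define T where "T v = (v, st (outp (replicate (s - v) True)) (inp [False]) (\<lambda>_. 0))" for v
  have 4: "runs [While (\<lambda>r ss. r \<noteq> 0) [tape_op (\<lambda>r. r - 1) 0 (\<lambda>s. (Some True, MoveRight))]]
      (T s) (s * (1 + 1) + 1) (T 0)"
  proof (rule runs_While_count)
    fix v assume "v < s"
    then have e: "s - v = Suc (s - Suc v)" by simp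
    show "fst (T (Suc v)) \<noteq> 0" by (simp add: T_def)
    show "runs [tape_op (\<lambda>r. r - 1) 0 (\<lambda>s. (Some True, MoveRight))] (T (Suc v)) 1 (T v)"
      using runs_tape_op[of 0 "snd (T (Suc v))" "\<lambda>r. r - 1" "\<lambda>s. (Some True, MoveRight)" "Suc v"]
      unfolding T_def e by (simp add: write_move_outp replicate_append_same)
  qed (simp add: T_def)
  have 5: "runs [put 0 False] (T 0) 1 (0, st (outp (unary s)) (inp [False]) (\<lambda>_. 0))"
    using runs_put0 by (simp add: T_def unary_def)
  have 6: "runs (rewind 0) (0, st (outp (unary s)) (inp [False]) (\<lambda>_. 0)) (2 * length (unary s) + 5)
      (0, st (inp (unary s)) (inp [False]) (\<lambda>_. 0))"
    using runs_rewind[of 0 "st (outp (unary s)) (inp [False]) (\<lambda>_. 0)" "unary s" 0]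
    by (simp add: unary_def)
  have T: "T s = (s, st (outp []) (inp [False]) (\<lambda>_. 0))"
    by (simp add: T_def)
  have "runs (write_answer p c d) (0, st (outp []) (inp (unary r)) ?c)
      ((2 * r + 1) + ((2 * n + 1) + ((2 * m + 1) + ((s * (1 + 1) + 1) + (1 + (2 * length (unary s) + 5))))))
      (0, st (inp (unary s)) (inp [False]) (\<lambda>_. 0))"
    unfolding write_answer_def append_Cons append_Nil
    by (rule runs_Cons[OF 1 runs_Cons[OF 2 runs_Cons[OF 3 runs_Cons[OF 4[unfolded T] runs_Cons[OF 5 6]]]]])
  then show ?thesis
    unfolding s_def[symmetric] by (rule runs_mono) (use p s in \<open>simp add: unary_def\<close>)
qed

section \<open>From the two programs to a polynomial-time reduction\<close>

lemma com_wf_basic: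
  assumes "0 < p"
  shows "\<forall>c \<in> set (inc k). com_wf p K c" "com_wf p K (dec id k)" "com_wf p K (put k b)"
    "com_wf p K (erase id k)" "com_wf p K copy" "\<forall>c \<in> set (emit k a). com_wf p K c"
    "\<forall>c \<in> set (emit_num xs). com_wf p K c" "\<forall>c \<in> set (rewind k). com_wf p K c"
proof -
  show inc: "\<forall>c \<in> set (inc k). com_wf p K c" for k by (auto simp: inc_def intro!: wf_tape_op)
  show dec: "com_wf p K (dec id k)" for k by (auto simp: dec_def intro!: wf_tape_op)
  show put: "com_wf p K (put k b)" for k b by (auto simp: put_def intro!: wf_tape_op)
  show "com_wf p K (erase id k)" by (auto simp: erase_def intro!: wf_tape_op)
  show "com_wf p K copy" by (simp add: copy_def)
  show emit: "\<forall>c \<in> set (emit k a). com_wf p K c" for k a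
    using inc dec put by (auto simp: emit_def)
  show "\<forall>c \<in> set (emit_num xs). com_wf p K c"
    using emit put by (auto simp: emit_num_def)
  show "\<forall>c \<in> set (rewind k). com_wf p K c"
    by (auto simp: rewind_def intro!: wf_tape_op)
qed

lemma com_wf_write_query:
  "0 < p \<Longrightarrow> \<forall>c \<in> set (write_query a1 a2 b1 b2 EL ER). com_wf p K c"
  by (auto simp: write_query_def read_num_def copy_rest_def com_wf_basic com_wf_basic[rule_format])

lemma com_wf_write_answer:
  "0 < p \<Longrightarrow> \<forall>c \<in> set (write_answer p x y). com_wf p K c"
  by (auto simp: write_answer_def erase_def dec_def com_wf_basic com_wf_basic[rule_format]
      intro!: wf_tape_op)

text \<open>All machine details end here: what remains is the counting identity \<open>F\<close>. By
  \<open>valid\<close> the query is a proper instance, so the oracle must answer it correctly; by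
  \<open>F'_less\<close> the unary answer has fewer than \<open>p\<close> ones, so it is read in
  constant time and without loss in the finite control.\<close>

lemma graph_problem_reduction:
  fixes F F' :: "nat bigraph \<Rightarrow> nat"
  assumes p: "0 < p"
    and valid: "\<And>n m es. set es \<subseteq> {0..<n} \<times> {0..<m} \<Longrightarrow>
      set (query_edges a1 b2 EL ER n m es) \<subseteq> {0..<a1 * n + a2 * m} \<times> {0..<b2 * m + b1 * n}"
    and F'_less: "\<And>G. F' G < p"
    and F: "\<And>n m es. set es \<subseteq> {0..<n} \<times> {0..<m} \<Longrightarrow> F (instance_graph n m es) =
      F' (instance_graph (a1 * n + a2 * m) (b2 * m + b1 * n) (query_edges a1 b2 EL ER n m es))
        * c ^ n * d ^ m mod p"
  shows "poly_time_reducible (graph_problem F) (graph_problem F')"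
proof -
  define P1 where "P1 = write_query a1 a2 b1 b2 EL ER"
  define P2 where "P2 = write_answer p c d"
  obtain C where C: "\<And>n m es. runs P1
     (0, st (inp (encode_instance n m es)) (outp []) (\<lambda>_. 0))
     (C * (length (encode_instance n m es) + 1)^2)
     (0, st (inp []) (inp (encode_instance (a1 * n + a2 * m) (b2 * m + b1 * n)
            (query_edges a1 b2 EL ER n m es))) ((\<lambda>_. 0)(0 := n, 1 := m)))"
    using runs_write_query unfolding P1_def by blast
  have "(2::nat) \<le> 7" by simp
  have wf: "\<forall>x \<in> set (P1 @ P2). com_wf p 7 x"
    unfolding P1_def P2_def using com_wf_write_query[OF p] com_wf_write_answer[OF p] by auto
  obtain M where M: "wf_oracle_tm M"
    and sim: "\<And>orc w s1 B1 a s2 B2 L W.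
      \<lbrakk>runs P1 (0, (cell [], cell (map Some w)) # replicate (7 - 1) (cell [], cell [])) B1 (0, s1);
       length s1 = 7; s1 ! 1 = (L, cell (map Some W));
       runs P2 (0, s1[1 := (cell [], cell (map Some (orc W)))]) B2 (0, s2);
       length s2 = 7; snd (s2 ! 0) = cell (map Some a)\<rbrakk>
      \<Longrightarrow> \<exists>t \<le> B1 + B2 + 1. outputs_in M orc w t a"
    by (rule ex_oracle_tm_program[OF wf \<open>2 \<le> 7\<close> p]) (rule that, assumption, blast)
  define b :: "nat poly" where "b = [:C + 6 * p + 15:] * [:1, 1:] ^ 2"
  have b: "poly b x = (C + 6 * p + 15) * (x + 1)^2" for x
    by (simp add: b_def add.commute)
  show ?thesis
    unfolding poly_time_reducible_def
  proof (intro exI[of _ M] exI[of _ b] conjI M allI impI ballI)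
    fix orc wa assume orc: "solves orc (graph_problem F')" and "wa \<in> graph_problem F"
    then obtain n m es where wa: "wa = (encode_instance n m es, unary (F (instance_graph n m es)))"
      and es: "set es \<subseteq> {0..<n} \<times> {0..<m}"
      by (auto simp: graph_problem_def)
    define w where "w = encode_instance n m es"
    define n' where "n' = a1 * n + a2 * m"
    define m' where "m' = b2 * m + b1 * n"
    define es' where "es' = query_edges a1 b2 EL ER n m es"
    define s where "s = F' (instance_graph n' m' es')"
    have "(encode_instance n' m' es', unary s) \<in> graph_problem F'"
      using valid[OF es] by (auto simp: graph_problem_def n'_def m'_def es'_def s_def)
    then have ans: "orc (encode_instance n' m' es') = unary s"
      using orc by (auto simp: solves_def)
    define s1 where "s1 = st (inp []) (inp (encode_instance n' m' es')) ((\<lambda>_. 0)(0 := n, 1 := m))"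
    define s2 where "s2 = st (inp (unary (s * c ^ n * d ^ m mod p))) (inp [False]) (\<lambda>_. 0)"
    \<comment> \<open>A blank tape is both an empty output tape and a counter at 0, so nothing has
      to be initialised.\<close>
    have init: "(cell [], cell (map Some w)) # replicate (7 - 1) (cell [], cell [])
        = st (inp w) (outp []) (\<lambda>_. 0)"
      by (simp add: st_def inp_def outp_def ctr_def numeral_eq_Suc)
    have r1: "runs P1 (0, (cell [], cell (map Some w)) # replicate (7 - 1) (cell [], cell []))
        (C * (length w + 1)^2) (0, s1)"
      unfolding init s1_def using C by (simp add: w_def n'_def m'_def es'_def)
    have "runs P2 (0, st (outp []) (inp (unary s)) ((\<lambda>_. 0)(0 := n, 1 := m)))
        (2 * n + 2 * m + 6 * p + 12) (0, s2)"
      unfolding P2_def s2_def using F'_less by (intro runs_write_answer) (simp add: s_def)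
    then have r2: "runs P2 (0, s1[1 := (cell [], cell (map Some (orc (encode_instance n' m' es'))))])
        (2 * n + 2 * m + 6 * p + 12) (0, s2)"
      by (simp add: ans s1_def inp_Nil inp_def[symmetric])
    have "\<exists>t \<le> C * (length w + 1)^2 + (2 * n + 2 * m + 6 * p + 12) + 1.
        outputs_in M orc w t (unary (s * c ^ n * d ^ m mod p))"
      by (rule sim[where orc = orc and W = "encode_instance n' m' es'", OF r1 _ _ r2]) (auto simp: s1_def s2_def inp_def)
    moreover have "C * (length w + 1)^2 + (2 * n + 2 * m + 6 * p + 12) + 1 \<le> poly b (length w)"
    proof -
      have "n + m \<le> length w" using length_edge_word_le(1) by (simp add: w_def)
      moreover have "length w + 1 \<le> (length w + 1)^2" "1 \<le> (length w + 1)^2"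
        by (simp_all add: power2_eq_square)
      moreover have "6 * p * 1 \<le> 6 * p * (length w + 1)^2"
        using calculation(3) by (rule mult_le_mono2)
      ultimately have "C * (length w + 1)^2 + (2 * n + 2 * m + 6 * p + 12) + 1
          \<le> C * (length w + 1)^2 + 6 * p * (length w + 1)^2 + 15 * (length w + 1)^2"
        by linarith
      then show ?thesis by (simp only: b add_mult_distrib)
    qed
    ultimately show "case wa of (w, a) \<Rightarrow> \<exists>t \<le> poly b (length w). outputs_in M orc w t a"
      using F[OF es] unfolding wa s_def n'_def m'_def es'_def w_def prod.case
      by (metis order_trans)
  qed
qed

subsection \<open>Homomorphisms from graphs with attached gadgets\<close>

lemma finite_homs:
  assumes "bigraph G" "bigraph H"
  shows "finite (homs G H)"
proof -
  have "homs G H \<subseteq> verts G \<rightarrow>\<^sub>E verts H" by (auto simp: homs_def)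
  moreover have "finite (verts G \<rightarrow>\<^sub>E verts H)"
    using assms by (intro finite_PiE) (auto simp: bigraph_def verts_def)
  ultimately show ?thesis by (rule finite_subset)
qed

text \<open>Counting is easy on a sum type that keeps the gadget copies apart, whereas an encoded
  instance has an interval of numbers as its vertices; this lemma passes from one to the
  other.\<close>

lemma card_homs_iso:
  assumes inj: "inj_on \<theta> (verts G)" and l: "\<theta> ` lpart G = lpart G'" and r: "\<theta> ` rpart G = rpart G'"
    and e: "map_prod \<theta> \<theta> ` edges G = edges G'" and G: "edges G \<subseteq> verts G \<times> verts G"
  shows "card (homs G H) = card (homs G' H)"
proof -
  define \<zeta> where "\<zeta> = inv_into (verts G) \<theta>"
  have v: "\<theta> ` verts G = verts G'" using l r by (auto simp: verts_def)
  have \<zeta>[simp]: "\<zeta> (\<theta> a) = a" if "a \<in> verts G" for a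
    unfolding \<zeta>_def using inj that by (rule inv_into_f_f)
  have \<theta>[simp]: "\<theta> (\<zeta> a) = a" if "a \<in> verts G'" for a
    unfolding \<zeta>_def using that by (intro f_inv_into_f) (simp add: v)
  have \<zeta>v: "\<zeta> a \<in> verts G" if "a \<in> verts G'" for a
    unfolding \<zeta>_def using that by (intro inv_into_into) (simp add: v)
  have sub: "lpart G \<subseteq> verts G" "rpart G \<subseteq> verts G" "lpart G' \<subseteq> verts G'" "rpart G' \<subseteq> verts G'"
    by (auto simp: verts_def)
  have "bij_betw (\<lambda>f. restrict (f \<circ> \<zeta>) (verts G')) (homs G H) (homs G' H)"
  proof (rule bij_betw_byWitness[where f' = "\<lambda>f. restrict (f \<circ> \<theta>) (verts G)"])
    show "\<forall>f\<in>homs G H. restrict (restrict (f \<circ> \<zeta>) (verts G') \<circ> \<theta>) (verts G) = f"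
      using v by (auto simp: homs_def PiE_def extensional_def fun_eq_iff)
    show "\<forall>f\<in>homs G' H. restrict (restrict (f \<circ> \<theta>) (verts G) \<circ> \<zeta>) (verts G') = f"
      using \<zeta>v by (auto simp: homs_def PiE_def extensional_def fun_eq_iff)
    show "(\<lambda>f. restrict (f \<circ> \<zeta>) (verts G')) ` homs G H \<subseteq> homs G' H"
    proof
      fix f' assume "f' \<in> (\<lambda>f. restrict (f \<circ> \<zeta>) (verts G')) ` homs G H"
      then obtain f where f: "f \<in> homs G H" and f': "f' = restrict (f \<circ> \<zeta>) (verts G')" by auto
      have f'\<theta>: "f' (\<theta> a) = f a" if "a \<in> verts G" for a
        using that v by (auto simp: f')
      have "f' \<in> verts G' \<rightarrow>\<^sub>E verts H"
        using f \<zeta>v by (auto simp: f' homs_def)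
      moreover have "f' ` lpart G' \<subseteq> lpart H" "f' ` rpart G' \<subseteq> rpart H"
        using f f'\<theta> sub by (auto simp: homs_def l[symmetric] r[symmetric] subset_iff)
      moreover have "\<forall>(u, v) \<in> edges G'. (f' u, f' v) \<in> edges H"
      proof clarify
        fix u' v' assume "(u', v') \<in> edges G'"
        then obtain u v where uv: "(u, v) \<in> edges G" "u' = \<theta> u" "v' = \<theta> v"
          by (auto simp: e[symmetric])
        then have "(f' u', f' v') = (f u, f v)" using G f'\<theta> by auto
        then show "(f' u', f' v') \<in> edges H" using f uv(1) by (auto simp: homs_def)
      qed
      ultimately show "f' \<in> homs G' H" by (simp add: homs_def)
    qed
    show "(\<lambda>f. restrict (f \<circ> \<theta>) (verts G)) ` homs G' H \<subseteq> homs G H"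
    proof
      fix f assume "f \<in> (\<lambda>f. restrict (f \<circ> \<theta>) (verts G)) ` homs G' H"
      then obtain f' where f': "f' \<in> homs G' H" and f: "f = restrict (f' \<circ> \<theta>) (verts G)" by auto
      have f\<theta>: "f a = f' (\<theta> a)" if "a \<in> verts G" for a
        using that by (simp add: f)
      have \<theta>m: "a \<in> verts G \<Longrightarrow> \<theta> a \<in> verts G'" "a \<in> lpart G \<Longrightarrow> \<theta> a \<in> lpart G'"
        "a \<in> rpart G \<Longrightarrow> \<theta> a \<in> rpart G'" for a
        using l r v by auto
      have f'm: "a \<in> verts G' \<Longrightarrow> f' a \<in> verts H" "a \<in> lpart G' \<Longrightarrow> f' a \<in> lpart H"
        "a \<in> rpart G' \<Longrightarrow> f' a \<in> rpart H" for a
        using f' by (auto simp: homs_def)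
      have "f \<in> verts G \<rightarrow>\<^sub>E verts H"
        using f'm(1) \<theta>m(1) by (simp add: f)
      moreover have "f ` lpart G \<subseteq> lpart H" "f ` rpart G \<subseteq> rpart H"
        using f'm(2,3) \<theta>m(2,3) f\<theta> sub by (auto simp: subset_iff)
      moreover have "\<forall>(u, v) \<in> edges G. (f u, f v) \<in> edges H"
      proof clarify
        fix u v assume "(u, v) \<in> edges G"
        then have "(\<theta> u, \<theta> v) \<in> edges G'" "u \<in> verts G" "v \<in> verts G"
          using e G by force+
        then show "(f u, f v) \<in> edges H" using f' f\<theta> by (auto simp: homs_def)
      qed
      ultimately show "f \<in> homs G H" by (simp add: homs_def)
    qed
  qed
  then show ?thesis by (rule bij_betw_same_card)
qed

text \<open>The vertex \<open>x\<close> of the \<open>i\<close>-th copy of \<open>KL\<close> plays the role of the \<open>i\<close>-th left vertex of the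
  original graph, and the vertex \<open>y\<close> of the \<open>j\<close>-th copy of \<open>KR\<close> that of its \<open>j\<close>-th right vertex.\<close>

definition glued :: "nat \<Rightarrow> nat \<Rightarrow> (nat \<times> nat) set \<Rightarrow> 'a bigraph \<Rightarrow> 'a \<Rightarrow> 'b bigraph \<Rightarrow> 'b \<Rightarrow>
    ((nat \<times> 'a) + (nat \<times> 'b)) bigraph" where
  "glued n m E KL x KR y =
     \<lparr>lpart = ({..<n} \<times> lpart KL) <+> ({..<m} \<times> lpart KR),
      rpart = ({..<n} \<times> rpart KL) <+> ({..<m} \<times> rpart KR),
      edges = (\<lambda>(i, a, b). (Inl (i, a), Inl (i, b))) ` ({..<n} \<times> edges KL) \<union>
              (\<lambda>(j, a, b). (Inr (j, a), Inr (j, b))) ` ({..<m} \<times> edges KR) \<union>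
              (\<lambda>(i, j). (Inl (i, x), Inr (j, y))) ` E\<rparr>"

lemma verts_glued: "verts (glued n m E KL x KR y) = ({..<n} \<times> verts KL) <+> ({..<m} \<times> verts KR)"
  by (auto simp: verts_def glued_def)

text \<open>Different copies meet only along \<open>E\<close>, so a homomorphism is the same as one
  homomorphism per copy, chosen freely except for the condition on the images of \<open>x\<close>
  and \<open>y\<close> along \<open>E\<close>.\<close>

lemma card_homs_glued:
  assumes K: "bigraph KL" "bigraph KR" and x: "x \<in> lpart KL" and y: "y \<in> rpart KR"
    and E: "E \<subseteq> {..<n} \<times> {..<m}"
  shows "card (homs (glued n m E KL x KR y) H) =
    card {(g, h) \<in> ({..<n} \<rightarrow>\<^sub>E homs KL H) \<times> ({..<m} \<rightarrow>\<^sub>E homs KR H).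
      \<forall>(i, j) \<in> E. (g i x, h j y) \<in> edges H}"
    (is "card (homs ?G H) = card ?X")
proof -
  \<comment> \<open>\<open>F\<close> and \<open>U\<close> are currying and its inverse; the
    restrictions make all functions extensional, without which they would not be mutually
    inverse.\<close>
  define F where "F f = (restrict (\<lambda>i. restrict (\<lambda>a. f (Inl (i, a))) (verts KL)) {..<n},
      restrict (\<lambda>j. restrict (\<lambda>b. f (Inr (j, b))) (verts KR)) {..<m})"
    for f :: "(nat \<times> 'a) + (nat \<times> 'b) \<Rightarrow> 'c"
  define U where "U gh = restrict (\<lambda>v. case v of Inl (i, a) \<Rightarrow> fst gh i a | Inr (j, b) \<Rightarrow> snd gh j b)
      (verts ?G)" for gh :: "(nat \<Rightarrow> 'a \<Rightarrow> 'c) \<times> (nat \<Rightarrow> 'b \<Rightarrow> 'c)"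
  have KE: "edges KL \<subseteq> verts KL \<times> verts KL" "edges KR \<subseteq> verts KR \<times> verts KR"
    "lpart KL \<subseteq> verts KL" "rpart KL \<subseteq> verts KL" "lpart KR \<subseteq> verts KR" "rpart KR \<subseteq> verts KR"
    using K by (auto simp: bigraph_def verts_def)
  have xy: "x \<in> verts KL" "y \<in> verts KR" using x y by (auto simp: verts_def)
  have U_Inl: "U gh (Inl (i, a)) = fst gh i a" if "i < n" "a \<in> verts KL" for gh i a
    using that by (auto simp: U_def verts_glued)
  have U_Inr: "U gh (Inr (j, a)) = snd gh j a" if "j < m" "a \<in> verts KR" for gh j a
    using that by (auto simp: U_def verts_glued)
  have "bij_betw F (homs ?G H) ?X"
  proof (rule bij_betw_byWitness[where f' = U])
    show "\<forall>f\<in>homs ?G H. U (F f) = f"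
    proof
      fix f assume f: "f \<in> homs ?G H"
      show "U (F f) = f"
      proof
        fix v show "U (F f) v = f v"
        proof (cases "v \<in> verts ?G")
          case True
          then show ?thesis by (auto simp: U_def F_def verts_glued)
        next
          case False
          then show ?thesis using f by (auto simp: U_def homs_def PiE_def extensional_def)
        qed
      qed
    qed
    show "\<forall>gh\<in>?X. F (U gh) = gh"
    proof
      fix gh assume gh: "gh \<in> ?X"
      obtain g h where [simp]: "gh = (g, h)" by (cases gh)
      have g: "g \<in> {..<n} \<rightarrow>\<^sub>E homs KL H" and h: "h \<in> {..<m} \<rightarrow>\<^sub>E homs KR H" using gh by auto
      have "fst (F (U gh)) i a = g i a" for i a
      proof (cases "i < n")
        case True
        then have "g i \<in> extensional (verts KL)" using g by (auto simp: homs_def PiE_def Pi_def)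
        then show ?thesis using True by (auto simp: F_def U_Inl extensional_def)
      next
        case False
        then show ?thesis using g by (auto simp: F_def PiE_def extensional_def)
      qed
      moreover have "snd (F (U gh)) j a = h j a" for j a
      proof (cases "j < m")
        case True
        then have "h j \<in> extensional (verts KR)" using h by (auto simp: homs_def PiE_def Pi_def)
        then show ?thesis using True by (auto simp: F_def U_Inr extensional_def)
      next
        case False
        then show ?thesis using h by (auto simp: F_def PiE_def extensional_def)
      qed
      ultimately show "F (U gh) = gh" by (simp add: prod_eq_iff fun_eq_iff)
    qed
    show "F ` homs ?G H \<subseteq> ?X"
    proof
      fix gh assume "gh \<in> F ` homs ?G H"
      then obtain f where f: "f \<in> homs ?G H" and gh: "gh = F f" by auto
      have fv: "f v \<in> verts H" if "v \<in> verts ?G" for v using f that by (auto simp: homs_def)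
      have fl: "f v \<in> lpart H" if "v \<in> lpart ?G" for v using f that by (auto simp: homs_def)
      have fr: "f v \<in> rpart H" if "v \<in> rpart ?G" for v using f that by (auto simp: homs_def)
      have fe: "(f u, f v) \<in> edges H" if "(u, v) \<in> edges ?G" for u v using f that by (auto simp: homs_def)
      have "restrict (\<lambda>a. f (Inl (i, a))) (verts KL) \<in> homs KL H" if i: "i < n" for i
      proof -
        have "(f (Inl (i, a)), f (Inl (i, b))) \<in> edges H" if "(a, b) \<in> edges KL" for a b
          using i that by (intro fe) (force simp: glued_def)
        moreover have "f (Inl (i, a)) \<in> lpart H" if "a \<in> lpart KL" for a
          using i that by (intro fl) (auto simp: glued_def)
        moreover have "f (Inl (i, a)) \<in> rpart H" if "a \<in> rpart KL" for a
          using i that by (intro fr) (auto simp: glued_def)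
        moreover have "f (Inl (i, a)) \<in> verts H" if "a \<in> verts KL" for a
          using i that by (intro fv) (auto simp: verts_glued)
        ultimately show ?thesis using KE by (auto simp: homs_def subset_iff)
      qed
      moreover have "restrict (\<lambda>a. f (Inr (i, a))) (verts KR) \<in> homs KR H" if i: "i < m" for i
      proof -
        have "(f (Inr (i, a)), f (Inr (i, b))) \<in> edges H" if "(a, b) \<in> edges KR" for a b
          using i that by (intro fe) (force simp: glued_def)
        moreover have "f (Inr (i, a)) \<in> lpart H" if "a \<in> lpart KR" for a
          using i that by (intro fl) (auto simp: glued_def)
        moreover have "f (Inr (i, a)) \<in> rpart H" if "a \<in> rpart KR" for a
          using i that by (intro fr) (auto simp: glued_def)
        moreover have "f (Inr (i, a)) \<in> verts H" if "a \<in> verts KR" for a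
          using i that by (intro fv) (auto simp: verts_glued)
        ultimately show ?thesis using KE by (auto simp: homs_def subset_iff)
      qed
      moreover have "(f (Inl (i, x)), f (Inr (j, y))) \<in> edges H" if "(i, j) \<in> E" for i j
        using that by (intro fe) (force simp: glued_def)
      ultimately show "gh \<in> ?X"
        using E xy by (auto simp: gh F_def)
    qed
    show "U ` ?X \<subseteq> homs ?G H"
    proof
      fix f assume "f \<in> U ` ?X"
      then obtain g h where f: "f = U (g, h)" and g: "g \<in> {..<n} \<rightarrow>\<^sub>E homs KL H"
        and h: "h \<in> {..<m} \<rightarrow>\<^sub>E homs KR H" and gh: "\<forall>(i, j) \<in> E. (g i x, h j y) \<in> edges H"
        by auto
      have gi: "g i \<in> homs KL H" if "i < n" for i using g that by auto
      have hj: "h j \<in> homs KR H" if "j < m" for j using h that by auto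
      have fl: "f (Inl (i, a)) = g i a" if "i < n" "a \<in> verts KL" for i a
        using that by (simp add: f U_Inl)
      have fr: "f (Inr (i, a)) = h i a" if "i < m" "a \<in> verts KR" for i a
        using that by (simp add: f U_Inr)
      have "f v \<in> verts H" if "v \<in> verts ?G" for v
      proof -
        have "g i a \<in> verts H" if "i < n" "a \<in> verts KL" for i a
          using gi[OF that(1)] that(2) by (auto simp: homs_def)
        moreover have "h i a \<in> verts H" if "i < m" "a \<in> verts KR" for i a
          using hj[OF that(1)] that(2) by (auto simp: homs_def)
        ultimately show ?thesis using that fl fr by (auto simp: verts_glued)
      qed
      then have "f \<in> verts ?G \<rightarrow>\<^sub>E verts H"
        by (auto simp: f U_def)
      moreover have "f v \<in> lpart H" if "v \<in> lpart ?G" for v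
      proof -
        from that consider (1) i a where "i < n" "a \<in> lpart KL" "v = Inl (i, a)"
          | (2) i a where "i < m" "a \<in> lpart KR" "v = Inr (i, a)"
          by (auto simp: glued_def)
        then show ?thesis
        proof cases
          case 1
          then have "a \<in> verts KL" using KE by auto
          then show ?thesis using 1 gi[of i] fl[of i a] by (auto simp: homs_def)
        next
          case 2
          then have "a \<in> verts KR" using KE by auto
          then show ?thesis using 2 hj[of i] fr[of i a] by (auto simp: homs_def)
        qed
      qed
      moreover have "f v \<in> rpart H" if "v \<in> rpart ?G" for v
      proof -
        from that consider (1) i a where "i < n" "a \<in> rpart KL" "v = Inl (i, a)"
          | (2) i a where "i < m" "a \<in> rpart KR" "v = Inr (i, a)"
          by (auto simp: glued_def)
        then show ?thesis
        proof cases
          case 1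
          then have "a \<in> verts KL" using KE by auto
          then show ?thesis using 1 gi[of i] fl[of i a] by (auto simp: homs_def)
        next
          case 2
          then have "a \<in> verts KR" using KE by auto
          then show ?thesis using 2 hj[of i] fr[of i a] by (auto simp: homs_def)
        qed
      qed
      moreover have "(f u, f v) \<in> edges H" if "(u, v) \<in> edges ?G" for u v
      proof -
        from that consider (1) i a b where "i < n" "(a, b) \<in> edges KL" "u = Inl (i, a)" "v = Inl (i, b)"
          | (2) i a b where "i < m" "(a, b) \<in> edges KR" "u = Inr (i, a)" "v = Inr (i, b)"
          | (3) i j where "(i, j) \<in> E" "u = Inl (i, x)" "v = Inr (j, y)"
          by (auto simp: glued_def)
        then show ?thesis
        proof cases
          case 1
          then have "a \<in> verts KL" "b \<in> verts KL" using KE by auto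
          then show ?thesis using 1 gi[of i] fl by (auto simp: homs_def)
        next
          case 2
          then have "a \<in> verts KR" "b \<in> verts KR" using KE by auto
          then show ?thesis using 2 hj[of i] fr by (auto simp: homs_def)
        next
          case 3
          then have "i < n" "j < m" using E by auto
          then show ?thesis using 3 gh xy fl fr by auto
        qed
      qed
      ultimately show "f \<in> homs ?G H" by (auto simp: homs_def)
    qed
  qed
  then show ?thesis by (rule bij_betw_same_card)
qed

text \<open>The pairs are sorted by the images \<phi> of the copies of \<open>x\<close> and \<psi>
  of the copies of \<open>y\<close>. The condition on \<open>E\<close> depends on these alone, so
  each fibre is either empty or a full product of sets counted by \<open>hom_at\<close>.\<close>

lemma card_glued_pairs:
  fixes n m :: nat
  assumes fin: "bigraph KL" "bigraph KR" "bigraph H" and x: "x \<in> lpart KL" and y: "y \<in> rpart KR"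
    and E: "E \<subseteq> {..<n} \<times> {..<m}"
  shows "card {(g, h) \<in> ({..<n} \<rightarrow>\<^sub>E homs KL H) \<times> ({..<m} \<rightarrow>\<^sub>E homs KR H).
      \<forall>(i, j) \<in> E. (g i x, h j y) \<in> edges H} =
    (\<Sum>\<phi> \<in> {..<n} \<rightarrow>\<^sub>E lpart H. \<Sum>\<psi> \<in> {..<m} \<rightarrow>\<^sub>E rpart H.
      of_bool (\<forall>(i, j) \<in> E. (\<phi> i, \<psi> j) \<in> edges H) *
        ((\<Prod>i<n. hom_at KL x H (\<phi> i)) * (\<Prod>j<m. hom_at KR y H (\<psi> j))))"
    (is "card ?X = _")
proof -
  let ?T = "({..<n} \<rightarrow>\<^sub>E lpart H) \<times> ({..<m} \<rightarrow>\<^sub>E rpart H)"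
  define t where "t gh = (restrict (\<lambda>i. fst gh i x) {..<n}, restrict (\<lambda>j. snd gh j y) {..<m})"
    for gh :: "(nat \<Rightarrow> 'a \<Rightarrow> 'c) \<times> (nat \<Rightarrow> 'b \<Rightarrow> 'c)"
  have finX: "finite ?X"
    by (rule finite_subset[of _ "({..<n} \<rightarrow>\<^sub>E homs KL H) \<times> ({..<m} \<rightarrow>\<^sub>E homs KR H)"])
      (auto intro!: finite_PiE finite_homs fin)
  have finT: "finite ?T"
    using fin(3) by (auto intro!: finite_PiE simp: bigraph_def)
  have tX: "t ` ?X \<subseteq> ?T"
  proof -
    have "g x \<in> lpart H" if "g \<in> homs KL H" for g using that x by (auto simp: homs_def)
    moreover have "h y \<in> rpart H" if "h \<in> homs KR H" for h using that y by (auto simp: homs_def)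
    ultimately show ?thesis by (auto simp: t_def PiE_iff split: if_splits)
  qed
  have fibre: "card {gh \<in> ?X. t gh = (\<phi>, \<psi>)} =
      of_bool (\<forall>(i, j) \<in> E. (\<phi> i, \<psi> j) \<in> edges H) *
        ((\<Prod>i<n. hom_at KL x H (\<phi> i)) * (\<Prod>j<m. hom_at KR y H (\<psi> j)))"
    if "\<phi> \<in> {..<n} \<rightarrow>\<^sub>E lpart H" "\<psi> \<in> {..<m} \<rightarrow>\<^sub>E rpart H" for \<phi> \<psi>
  proof -
    have r1: "restrict f {..<n} = \<phi> \<longleftrightarrow> (\<forall>i<n. f i = \<phi> i)" for f
      using that(1) by (auto simp: fun_eq_iff PiE_def extensional_def)
    have r2: "restrict f {..<m} = \<psi> \<longleftrightarrow> (\<forall>i<m. f i = \<psi> i)" for f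
      using that(2) by (auto simp: fun_eq_iff PiE_def extensional_def)
    have "{gh \<in> ?X. t gh = (\<phi>, \<psi>)} = (if \<forall>(i, j) \<in> E. (\<phi> i, \<psi> j) \<in> edges H then
        (\<Pi>\<^sub>E i\<in>{..<n}. {g \<in> homs KL H. g x = \<phi> i}) \<times> (\<Pi>\<^sub>E j\<in>{..<m}. {h \<in> homs KR H. h y = \<psi> j}) else {})"
      (is "?l = ?r")
    proof (rule set_eqI)
      fix gh :: "(nat \<Rightarrow> 'a \<Rightarrow> 'c) \<times> (nat \<Rightarrow> 'b \<Rightarrow> 'c)"
      obtain g h where gh: "gh = (g, h)" by (cases gh)
      have "(\<forall>(i, j) \<in> E. (g i x, h j y) \<in> edges H) \<longleftrightarrow> (\<forall>(i, j) \<in> E. (\<phi> i, \<psi> j) \<in> edges H)"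
        if "\<forall>i<n. g i x = \<phi> i" "\<forall>j<m. h j y = \<psi> j"
        using E that by (intro ball_cong refl) auto
      moreover have "g \<in> (\<Pi>\<^sub>E i\<in>{..<n}. {g \<in> homs KL H. g x = \<phi> i}) \<longleftrightarrow>
          g \<in> {..<n} \<rightarrow>\<^sub>E homs KL H \<and> (\<forall>i<n. g i x = \<phi> i)"
        "h \<in> (\<Pi>\<^sub>E j\<in>{..<m}. {h \<in> homs KR H. h y = \<psi> j}) \<longleftrightarrow>
          h \<in> {..<m} \<rightarrow>\<^sub>E homs KR H \<and> (\<forall>j<m. h j y = \<psi> j)"
        by (auto simp: PiE_iff)
      ultimately show "gh \<in> ?l \<longleftrightarrow> gh \<in> ?r"
        unfolding gh by (simp add: t_def r1 r2 del: split_paired_All split_paired_Ball_Sigma) (meson)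
    qed
    then show ?thesis
      by (simp add: card_cartesian_product card_PiE hom_at_def)
  qed
  have "card ?X = (\<Sum>z\<in>?T. card {gh \<in> ?X. t gh = z})"
    using sum.group[OF finX finT tX, of "\<lambda>_. 1 :: nat"] by simp
  also have "\<dots> = (\<Sum>\<phi> \<in> {..<n} \<rightarrow>\<^sub>E lpart H. \<Sum>\<psi> \<in> {..<m} \<rightarrow>\<^sub>E rpart H. card {gh \<in> ?X. t gh = (\<phi>, \<psi>)})"
    by (simp add: sum.cartesian_product case_prod_beta)
  also have "\<dots> = (\<Sum>\<phi> \<in> {..<n} \<rightarrow>\<^sub>E lpart H. \<Sum>\<psi> \<in> {..<m} \<rightarrow>\<^sub>E rpart H.
      of_bool (\<forall>(i, j) \<in> E. (\<phi> i, \<psi> j) \<in> edges H) *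
        ((\<Prod>i<n. hom_at KL x H (\<phi> i)) * (\<Prod>j<m. hom_at KR y H (\<psi> j))))"
    by (intro sum.cong refl fibre)
  finally show ?thesis .
qed

text \<open>Once the set \<open>I\<close> of arguments sent to \<open>A\<close> is fixed, the values
  are independent, and the sum of products factors into one sum over \<open>A\<close> or
  \<open>C\<close> for each argument. The lemma serves both sides, with \<open>A\<close>,
  \<open>C\<close> on the left and \<open>D\<close>, \<open>B\<close> on the right.\<close>

lemma sum_PiE_two_classes:
  fixes w :: "'v \<Rightarrow> 'r::comm_semiring_1"
  assumes N: "finite N" and fin: "finite A" "finite C" and disj: "A \<inter> C = {}"
  shows "(\<Sum>\<phi> \<in> N \<rightarrow>\<^sub>E A \<union> C. F {i \<in> N. \<phi> i \<in> A} * (\<Prod>i\<in>N. w (\<phi> i))) =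
    (\<Sum>I \<in> Pow N. F I * (sum w A ^ card I * sum w C ^ (card N - card I)))"
proof -
  let ?\<Phi> = "N \<rightarrow>\<^sub>E A \<union> C"
  have "(\<Sum>\<phi> \<in> ?\<Phi>. F {i \<in> N. \<phi> i \<in> A} * (\<Prod>i\<in>N. w (\<phi> i))) =
      (\<Sum>I \<in> Pow N. \<Sum>\<phi> \<in> {\<phi> \<in> ?\<Phi>. {i \<in> N. \<phi> i \<in> A} = I}. F {i \<in> N. \<phi> i \<in> A} * (\<Prod>i\<in>N. w (\<phi> i)))"
    by (rule sum.group[symmetric]) (use N fin in \<open>auto intro!: finite_PiE\<close>)
  also have "\<dots> = (\<Sum>I \<in> Pow N. F I * (sum w A ^ card I * sum w C ^ (card N - card I)))"
  proof (rule sum.cong[OF refl])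
    fix I assume "I \<in> Pow N"
    then have I: "I \<subseteq> N" by simp
    have eq: "{\<phi> \<in> ?\<Phi>. {i \<in> N. \<phi> i \<in> A} = I} = (\<Pi>\<^sub>E i\<in>N. if i \<in> I then A else C)" (is "?l = ?r")
    proof (intro equalityI subsetI)
      fix \<phi> assume "\<phi> \<in> ?l"
      then show "\<phi> \<in> ?r" by (auto simp: PiE_iff)
    next
      fix \<phi> assume \<phi>: "\<phi> \<in> ?r"
      then have *: "\<phi> i \<in> (if i \<in> I then A else C)" if "i \<in> N" for i
        using that by (auto simp: PiE_iff)
      have "{i \<in> N. \<phi> i \<in> A} = I"
        using * I disj by (force split: if_splits)
      moreover have "\<phi> \<in> ?\<Phi>"
        using * \<phi> by (fastforce simp: PiE_iff split: if_splits)
      ultimately show "\<phi> \<in> ?l" by simp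
    qed
    have "(\<Sum>\<phi> \<in> {\<phi> \<in> ?\<Phi>. {i \<in> N. \<phi> i \<in> A} = I}. F {i \<in> N. \<phi> i \<in> A} * (\<Prod>i\<in>N. w (\<phi> i)))
        = F I * (\<Sum>\<phi> \<in> {\<phi> \<in> ?\<Phi>. {i \<in> N. \<phi> i \<in> A} = I}. \<Prod>i\<in>N. w (\<phi> i))"
      by (simp add: sum_distrib_left)
    also have "(\<Sum>\<phi> \<in> {\<phi> \<in> ?\<Phi>. {i \<in> N. \<phi> i \<in> A} = I}. \<Prod>i\<in>N. w (\<phi> i))
        = (\<Prod>i\<in>N. sum w (if i \<in> I then A else C))"
      unfolding eq by (rule prod_sum_PiE[symmetric]) (use N fin in auto)
    also have "\<dots> = (\<Prod>i\<in>N. if i \<in> I then sum w A else sum w C)"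
      by (rule prod.cong) auto
    also have "\<dots> = sum w A ^ card I * sum w C ^ (card N - card I)"
    proof -
      have "N \<inter> {i. i \<in> I} = I" "N \<inter> - {i. i \<in> I} = N - I" using I by auto
      moreover have "card (N - I) = card N - card I"
        using I N finite_subset by (intro card_Diff_subset) auto
      ultimately show ?thesis using N by (simp add: prod.If_cases)
    qed
    finally show "(\<Sum>\<phi> \<in> {\<phi> \<in> ?\<Phi>. {i \<in> N. \<phi> i \<in> A} = I}. F {i \<in> N. \<phi> i \<in> A} * (\<Prod>i\<in>N. w (\<phi> i)))
        = F I * (sum w A ^ card I * sum w C ^ (card N - card I))" .
  qed
  finally show ?thesis .
qed

section \<open>Discarding maps of weight zero modulo \<open>q\<close>\<close>

lemma cong_sum_subset:
  fixes f :: "'i \<Rightarrow> int"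
  assumes "finite S" "S' \<subseteq> S" "\<And>s. s \<in> S - S' \<Longrightarrow> [f s = 0] (mod q)"
  shows "[sum f S = sum f S'] (mod q)"
proof -
  have "[sum f (S - S') = 0] (mod q)"
    using cong_sum[of "S - S'" f "\<lambda>_. 0" q] assms(3) by simp
  then have "[sum f (S - S') + sum f S' = 0 + sum f S'] (mod q)"
    by (rule cong_add) simp
  then show ?thesis using sum.subset_diff[OF assms(2,1), of f] by simp
qed

text \<open>A map that leaves \<open>L'\<close> somewhere has a factor divisible by
  \<open>q\<close>, whatever \<open>F\<close> contributes.\<close>

lemma cong_sum_PiE_subset:
  fixes w :: "'v \<Rightarrow> int"
  assumes "finite L" "L' \<subseteq> L" "\<And>v. v \<in> L - L' \<Longrightarrow> [w v = 0] (mod q)"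
  shows "[(\<Sum>\<phi> \<in> {..<n::nat} \<rightarrow>\<^sub>E L. (\<Prod>i<n. w (\<phi> i)) * F \<phi>)
    = (\<Sum>\<phi> \<in> {..<n} \<rightarrow>\<^sub>E L'. (\<Prod>i<n. w (\<phi> i)) * F \<phi>)] (mod q)"
proof (rule cong_sum_subset)
  show "finite ({..<n} \<rightarrow>\<^sub>E L)" using assms by (intro finite_PiE) auto
  show "({..<n} \<rightarrow>\<^sub>E L') \<subseteq> ({..<n} \<rightarrow>\<^sub>E L)" using assms by (intro PiE_mono) auto
  fix \<phi> assume "\<phi> \<in> ({..<n} \<rightarrow>\<^sub>E L) - ({..<n} \<rightarrow>\<^sub>E L')"
  then obtain i where "i < n" "\<phi> i \<in> L - L'" by (auto simp: PiE_iff)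
  then have "q dvd w (\<phi> i)" "w (\<phi> i) dvd (\<Prod>i<n. w (\<phi> i))"
    using assms(3) by (auto simp: cong_0_iff intro: dvd_prodI)
  then show "[(\<Prod>i<n. w (\<phi> i)) * F \<phi> = 0] (mod q)"
    by (auto simp: cong_0_iff intro: dvd_mult2 dvd_trans)
qed

subsection \<open>The reduction\<close>

lemma grid_less: "a < k \<Longrightarrow> i < n \<Longrightarrow> a * n + i < k * (n :: nat)"
proof -
  assume "a < k" "i < n"
  then have "a * n + i < Suc a * n" "Suc a * n \<le> k * n" by (simp, intro mult_le_mono1, simp)
  then show ?thesis by linarith
qed

text \<open>Division with remainder by \<open>n\<close> recovers \<open>f a\<close> and
  \<open>i\<close>, so \<open>n\<close> copies of \<open>k\<close> vertices fill an interval without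
  gaps.\<close>

lemma grid_image:
  assumes f: "f ` V = {..<k}"
  shows "(\<lambda>(i, a). s + (f a * n + i)) ` ({..<n} \<times> V) = {s..<s + k * (n :: nat)}"
proof (intro equalityI subsetI)
  fix v assume "v \<in> (\<lambda>(i, a). s + (f a * n + i)) ` ({..<n} \<times> V)"
  then obtain i a where "i < n" "a \<in> V" "v = s + (f a * n + i)" by auto
  moreover have "f a < k" using f \<open>a \<in> V\<close> by auto
  ultimately show "v \<in> {s..<s + k * n}" using grid_less[of "f a" k i n] by simp
next
  fix v assume v: "v \<in> {s..<s + k * n}"
  define u where "u = v - s"
  have u: "u < k * n" "v = s + u" using v by (auto simp: u_def)
  then have n: "0 < n" by (cases n) auto
  have "u div n < k" using u by (simp add: less_mult_imp_div_less)
  then have "u div n \<in> f ` V" using f by simp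
  then obtain a where a: "a \<in> V" "f a = u div n" by auto
  have "v = s + (f a * n + u mod n)" using u a by simp
  moreover have "u mod n < n" using n by simp
  ultimately show "v \<in> (\<lambda>(i, a). s + (f a * n + i)) ` ({..<n} \<times> V)"
    using a by force
qed

text \<open>Any enumeration works after a transposition that brings \<open>x\<close> to 0. Then copy
  \<open>i\<close> of \<open>x\<close> has index \<open>0 * n + i\<close>, the index of the original
  vertex.\<close>

lemma ex_numbering_from:
  assumes "finite V" "x \<in> V"
  obtains f where "bij_betw f V {..<card V}" "f x = (0 :: nat)"
proof -
  obtain h where h: "bij_betw h V {0..<card V}"
    using ex_bij_betw_finite_nat[OF assms(1)] by blast
  have "h x \<in> {0..<card V}" "0 \<in> {0..<card V}"
    using h assms by (auto simp: bij_betw_def card_gt_0_iff)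
  then have "bij_betw (Transposition.transpose (h x) 0) {0..<card V} {0..<card V}"
    by (intro permutes_imp_bij permutes_swap_id)
  then have "bij_betw (Transposition.transpose (h x) 0 \<circ> h) V {0..<card V}"
    using h bij_betw_trans by blast
  then show thesis
    by (intro that[of "Transposition.transpose (h x) 0 \<circ> h"]) (simp_all add: atLeast0LessThan)
qed

lemma card_homs_query_graph:
  fixes KL :: "'a bigraph" and KR :: "'b bigraph"
  assumes K: "bigraph KL" "bigraph KR" and x: "x \<in> lpart KL" and y: "y \<in> rpart KR"
    and es: "set es \<subseteq> {0..<n} \<times> {0..<m}"
    and pL: "bij_betw pL (lpart KL) {..<a1}" "pL x = 0" and qL: "bij_betw qL (rpart KL) {..<b1}"
    and pR: "bij_betw pR (lpart KR) {..<a2}" and qR: "bij_betw qR (rpart KR) {..<b2}" "qR y = 0"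
    and EL: "set EL = map_prod pL qL ` edges KL" and ER: "set ER = map_prod pR qR ` edges KR"
  shows "set (query_edges a1 b2 EL ER n m es) \<subseteq> {0..<a1 * n + a2 * m} \<times> {0..<b2 * m + b1 * n}"
    and "card (homs (instance_graph (a1 * n + a2 * m) (b2 * m + b1 * n)
      (query_edges a1 b2 EL ER n m es)) H) = card (homs (glued n m (set es) KL x KR y) H)"
proof -
  define n' where "n' = a1 * n + a2 * m"
  define m' where "m' = b2 * m + b1 * n"
  define G where "G = glued n m (set es) KL x KR y"
  define G' where "G' = instance_graph n' m' (query_edges a1 b2 EL ER n m es)"
  \<comment> \<open>Left indices: copies of \<open>KL\<close>, then of \<open>KR\<close>. Right
    indices: copies of \<open>KR\<close> first, so that the copies of \<open>y\<close> start at
    \<open>n'\<close>, and then those of \<open>KL\<close>.\<close>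
  define \<theta> where "\<theta> v = (case v of
      Inl (i, a) \<Rightarrow> if a \<in> lpart KL then 0 + (pL a * n + i) else (n' + b2 * m) + (qL a * n + i)
    | Inr (j, b) \<Rightarrow> if b \<in> lpart KR then a1 * n + (pR b * m + j) else n' + (qR b * m + j))"
    for v :: "(nat \<times> 'a) + (nat \<times> 'b)"
  have im: "pL ` lpart KL = {..<a1}" "qL ` rpart KL = {..<b1}" "pR ` lpart KR = {..<a2}"
    "qR ` rpart KR = {..<b2}"
    using pL qL pR qR by (auto simp: bij_betw_def)
  have disj: "a \<in> rpart KL \<Longrightarrow> a \<notin> lpart KL" "b \<in> rpart KR \<Longrightarrow> b \<notin> lpart KR" for a b
    using K by (auto simp: bigraph_def)
  have KE: "(a, b) \<in> edges KL \<Longrightarrow> a \<in> lpart KL \<and> b \<in> rpart KL"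
    "(c, d) \<in> edges KR \<Longrightarrow> c \<in> lpart KR \<and> d \<in> rpart KR" for a b c d
    using K by (auto simp: bigraph_def)
  have 1: "\<theta> ` Inl ` ({..<n} \<times> lpart KL) = {0..<a1 * n}"
  proof -
    have "\<theta> ` Inl ` ({..<n} \<times> lpart KL) = (\<lambda>(i, a). 0 + (pL a * n + i)) ` ({..<n} \<times> lpart KL)"
      unfolding image_image by (rule image_cong) (auto simp: \<theta>_def)
    then show ?thesis unfolding grid_image[OF im(1)] by simp
  qed
  have 2: "\<theta> ` Inr ` ({..<m} \<times> lpart KR) = {a1 * n..<n'}"
  proof -
    have "\<theta> ` Inr ` ({..<m} \<times> lpart KR) = (\<lambda>(i, a). a1 * n + (pR a * m + i)) ` ({..<m} \<times> lpart KR)"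
      unfolding image_image by (rule image_cong) (auto simp: \<theta>_def)
    then show ?thesis unfolding grid_image[OF im(3)] by (simp add: n'_def)
  qed
  have 3: "\<theta> ` Inl ` ({..<n} \<times> rpart KL) = {n' + b2 * m..<n' + m'}"
  proof -
    have "\<theta> ` Inl ` ({..<n} \<times> rpart KL) =
        (\<lambda>(i, a). (n' + b2 * m) + (qL a * n + i)) ` ({..<n} \<times> rpart KL)"
      unfolding image_image by (rule image_cong) (auto simp: \<theta>_def disj)
    then show ?thesis unfolding grid_image[OF im(2)] by (simp add: m'_def add.assoc)
  qed
  have 4: "\<theta> ` Inr ` ({..<m} \<times> rpart KR) = {n'..<n' + b2 * m}"
  proof -
    have "\<theta> ` Inr ` ({..<m} \<times> rpart KR) = (\<lambda>(i, a). n' + (qR a * m + i)) ` ({..<m} \<times> rpart KR)"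
      unfolding image_image by (rule image_cong) (auto simp: \<theta>_def disj)
    then show ?thesis unfolding grid_image[OF im(4)] by simp
  qed
  have l: "\<theta> ` lpart G = lpart G'"
    unfolding G_def G'_def glued_def instance_graph_def
    by (simp add: Plus_def image_Un 1 2) (auto simp: n'_def)
  have r: "\<theta> ` rpart G = rpart G'"
    unfolding G_def G'_def glued_def instance_graph_def
    by (simp add: Plus_def image_Un 3 4) (auto simp: m'_def)
  have fin: "finite (verts KL)" "finite (verts KR)"
    using K by (auto simp: verts_def bigraph_def)
  have inj: "inj_on \<theta> (verts G)"
  \<comment> \<open>The four blocks are already known to fill an interval as long as the number of
    vertices, so injectivity follows by counting, with no comparison of indices.\<close>
  proof (rule eq_card_imp_inj_on)
    show "finite (verts G)" unfolding G_def verts_glued using fin by auto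
    have "card (verts KL) = a1 + b1" "card (verts KR) = a2 + b2"
      using K pL(1) qL pR qR(1)
      by (auto simp: verts_def bigraph_def card_Un_disjoint dest!: bij_betw_same_card)
    then have "card (verts G) = n' + m'"
      unfolding G_def verts_glued using fin
      by (simp add: card_Plus card_cartesian_product n'_def m'_def algebra_simps)
    moreover have "\<theta> ` verts G = {0..<n' + m'}"
      unfolding verts_def image_Un l r by (auto simp: G'_def instance_graph_def)
    ultimately show "card (\<theta> ` verts G) = card (verts G)" by simp
  qed
  let ?EL = "(\<lambda>(i, a, b). (pL a * n + i, b2 * m + qL b * n + i)) ` ({..<n} \<times> edges KL)"
  let ?ER = "(\<lambda>(j, a, b). (a1 * n + pR a * m + j, qR b * m + j)) ` ({..<m} \<times> edges KR)"
  have "set (concat (map (\<lambda>i. map (\<lambda>(a, b). (a * n + i, b2 * m + b * n + i)) EL) (rev [0..<n]))) = ?EL"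
    by (force simp: EL)
  moreover have "set (concat (map (\<lambda>j. map (\<lambda>(a, b). (a1 * n + a * m + j, b * m + j)) ER) (rev [0..<m]))) = ?ER"
    by (force simp: ER)
  ultimately have q: "set (query_edges a1 b2 EL ER n m es) = set es \<union> ?EL \<union> ?ER"
    by (simp add: query_edges_def Un_assoc)
  have E1: "map_prod \<theta> \<theta> ` (\<lambda>(i, a, b). (Inl (i, a), Inl (i, b))) ` ({..<n} \<times> edges KL)
      = (\<lambda>(i, j). (i, n' + j)) ` ?EL"
    unfolding image_image by (rule image_cong) (auto simp: \<theta>_def disj KE dest: KE)
  have E2: "map_prod \<theta> \<theta> ` (\<lambda>(i, a, b). (Inr (i, a), Inr (i, b))) ` ({..<m} \<times> edges KR)
      = (\<lambda>(i, j). (i, n' + j)) ` ?ER"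
    unfolding image_image by (rule image_cong) (auto simp: \<theta>_def disj KE dest: KE)
  have E3: "map_prod \<theta> \<theta> ` (\<lambda>(i, j). (Inl (i, x), Inr (j, y))) ` set es
      = (\<lambda>(i, j). (i, n' + j)) ` set es"
    unfolding image_image by (rule image_cong) (use x y disj(2)[OF y] pL(2) qR(2) in \<open>auto simp: \<theta>_def\<close>)
  have e: "map_prod \<theta> \<theta> ` edges G = edges G'"
    unfolding G_def G'_def glued_def instance_graph_def
    by (simp add: image_Un E1 E2 E3 q Un_ac del: image_image)
  have GE: "edges G \<subseteq> verts G \<times> verts G"
  proof -
    have "edges KL \<subseteq> verts KL \<times> verts KL" "edges KR \<subseteq> verts KR \<times> verts KR" "x \<in> verts KL" "y \<in> verts KR"
      using K x y by (auto simp: verts_def bigraph_def)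
    then show ?thesis
      unfolding G_def verts_glued using es by (auto simp: glued_def)
  qed
  show "card (homs (instance_graph (a1 * n + a2 * m) (b2 * m + b1 * n)
      (query_edges a1 b2 EL ER n m es)) H) = card (homs (glued n m (set es) KL x KR y) H)"
    using card_homs_iso[OF inj l r e GE, of H] by (simp add: G_def G'_def n'_def m'_def)
  \<comment> \<open>The index bounds are read off the isomorphism: edges of the glued graph join
    left to right vertices, whose images are the two intervals.\<close>
  have "edges G \<subseteq> lpart G \<times> rpart G"
    using K x y es by (auto simp: G_def glued_def bigraph_def)
  then have "map_prod \<theta> \<theta> ` edges G \<subseteq> \<theta> ` lpart G \<times> \<theta> ` rpart G" by auto
  then have "edges G' \<subseteq> {0..<n'} \<times> {n'..<n' + m'}"
    unfolding e l r by (simp add: G'_def instance_graph_def)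
  then show "set (query_edges a1 b2 EL ER n m es) \<subseteq> {0..<a1 * n + a2 * m} \<times> {0..<b2 * m + b1 * n}"
    by (force simp: G'_def instance_graph_def n'_def[symmetric] m'_def[symmetric])
qed

text \<open>The last fact is the key: within the thick Z-graph, adjacency is the statement that not
  both ends are selected, with \<open>A\<close> and \<open>D\<close> as the selected
  vertices.\<close>

lemma induced_thick_ZD:
  assumes "bigraph H" "induced_thick_Z H A B C D"
  shows "A \<union> C \<subseteq> lpart H" "B \<union> D \<subseteq> rpart H" "A \<inter> C = {}" "B \<inter> D = {}"
    and "u \<in> A \<union> C \<Longrightarrow> v \<in> B \<union> D \<Longrightarrow> (u, v) \<in> edges H \<longleftrightarrow> \<not> (u \<in> A \<and> v \<in> D)"
proof -
  have Z: "thick_Z_graph (induced_subgraph H (A \<union> B \<union> C \<union> D)) A B C D"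
    using assms by (simp add: induced_thick_Z_def)
  show "A \<union> C \<subseteq> lpart H" "B \<union> D \<subseteq> rpart H" "A \<inter> C = {}" "B \<inter> D = {}"
    using Z by (auto simp: thick_Z_graph_def induced_subgraph_def)
  show "(u, v) \<in> edges H \<longleftrightarrow> \<not> (u \<in> A \<and> v \<in> D)" if "u \<in> A \<union> C" "v \<in> B \<union> D"
    using Z that by (auto simp: thick_Z_graph_def induced_subgraph_def)
qed

lemma weighted_homs_cong_independent_sets:
  fixes wL wR :: "'v \<Rightarrow> int" and n m :: nat
  assumes H: "bigraph H" and Z: "induced_thick_Z H A B C D" and E: "E \<subseteq> {..<n} \<times> {..<m}"
    and wL: "\<And>v. v \<in> lpart H - (A \<union> C) \<Longrightarrow> [wL v = 0] (mod q)"
    and wR: "\<And>v. v \<in> rpart H - (B \<union> D) \<Longrightarrow> [wR v = 0] (mod q)"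
  shows "[(\<Sum>\<phi> \<in> {..<n} \<rightarrow>\<^sub>E lpart H. \<Sum>\<psi> \<in> {..<m} \<rightarrow>\<^sub>E rpart H.
      of_bool (\<forall>(i, j) \<in> E. (\<phi> i, \<psi> j) \<in> edges H) * ((\<Prod>i<n. wL (\<phi> i)) * (\<Prod>j<m. wR (\<psi> j)))) =
    (\<Sum>I \<in> Pow {..<n}. \<Sum>J \<in> Pow {..<m}. of_bool (\<forall>(i, j) \<in> E. \<not> (i \<in> I \<and> j \<in> J)) *
      ((sum wL A ^ card I * sum wL C ^ (n - card I)) * (sum wR D ^ card J * sum wR B ^ (m - card J))))]
    (mod q)"
proof -
  note ZD = induced_thick_ZD[OF H Z]
  have fin: "finite (lpart H)" "finite (rpart H)" using H by (auto simp: bigraph_def)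
  then have finZ: "finite A" "finite B" "finite C" "finite D"
    using ZD(1,2) by (auto dest: finite_subset)
  let ?c = "\<lambda>\<phi> \<psi>. of_bool (\<forall>(i, j) \<in> E. (\<phi> i, \<psi> j) \<in> edges H) :: int"
  let ?k = "\<lambda>I J. of_bool (\<forall>(i, j) \<in> E. \<not> (i \<in> I \<and> j \<in> J)) :: int"
  let ?wL = "\<lambda>\<phi>. \<Prod>i<n. wL (\<phi> i)"
  let ?wR = "\<lambda>\<psi>. \<Prod>j<m. wR (\<psi> j)"
  let ?sR = "\<lambda>J. sum wR D ^ card J * sum wR B ^ (m - card J)"
  let ?sL = "\<lambda>I. sum wL A ^ card I * sum wL C ^ (n - card I)"
  have "(\<Sum>\<phi> \<in> {..<n} \<rightarrow>\<^sub>E lpart H. \<Sum>\<psi> \<in> {..<m} \<rightarrow>\<^sub>E rpart H. ?c \<phi> \<psi> * (?wL \<phi> * ?wR \<psi>)) =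
      (\<Sum>\<phi> \<in> {..<n} \<rightarrow>\<^sub>E lpart H. ?wL \<phi> * (\<Sum>\<psi> \<in> {..<m} \<rightarrow>\<^sub>E rpart H. ?wR \<psi> * ?c \<phi> \<psi>))"
    by (simp add: sum_distrib_left ac_simps)
  also have "[\<dots> = (\<Sum>\<phi> \<in> {..<n} \<rightarrow>\<^sub>E A \<union> C. ?wL \<phi> * (\<Sum>\<psi> \<in> {..<m} \<rightarrow>\<^sub>E rpart H. ?wR \<psi> * ?c \<phi> \<psi>))] (mod q)"
    by (rule cong_sum_PiE_subset) (use fin ZD wL in auto)
  also have "[(\<Sum>\<phi> \<in> {..<n} \<rightarrow>\<^sub>E A \<union> C. ?wL \<phi> * (\<Sum>\<psi> \<in> {..<m} \<rightarrow>\<^sub>E rpart H. ?wR \<psi> * ?c \<phi> \<psi>)) =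
      (\<Sum>\<phi> \<in> {..<n} \<rightarrow>\<^sub>E A \<union> C. ?wL \<phi> * (\<Sum>\<psi> \<in> {..<m} \<rightarrow>\<^sub>E D \<union> B. ?wR \<psi> * ?c \<phi> \<psi>))] (mod q)"
    by (intro cong_sum cong_mult cong_refl cong_sum_PiE_subset) (use fin ZD wR in auto)
  \<comment> \<open>From here on the edge condition sees \<phi> and \<psi> only through the sets of
    arguments sent to \<open>A\<close> and to \<open>D\<close>, which is what allows grouping by
    these sets.\<close>
  also have "(\<Sum>\<phi> \<in> {..<n} \<rightarrow>\<^sub>E A \<union> C. ?wL \<phi> * (\<Sum>\<psi> \<in> {..<m} \<rightarrow>\<^sub>E D \<union> B. ?wR \<psi> * ?c \<phi> \<psi>)) =
      (\<Sum>\<phi> \<in> {..<n} \<rightarrow>\<^sub>E A \<union> C. ?wL \<phi> *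
        (\<Sum>\<psi> \<in> {..<m} \<rightarrow>\<^sub>E D \<union> B. ?k {i \<in> {..<n}. \<phi> i \<in> A} {j \<in> {..<m}. \<psi> j \<in> D} * ?wR \<psi>))"
  proof (rule sum.cong[OF refl], rule arg_cong[of _ _ "(*) _"], rule sum.cong[OF refl])
    fix \<phi> \<psi> assume \<phi>: "\<phi> \<in> {..<n} \<rightarrow>\<^sub>E A \<union> C" and \<psi>: "\<psi> \<in> {..<m} \<rightarrow>\<^sub>E D \<union> B"
    have "(\<phi> i, \<psi> j) \<in> edges H \<longleftrightarrow> \<not> (i \<in> {i \<in> {..<n}. \<phi> i \<in> A} \<and> j \<in> {j \<in> {..<m}. \<psi> j \<in> D})"
      if "(i, j) \<in> E" for i j
    proof -
      have "i < n" "j < m" using E that by auto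
      moreover then have "\<phi> i \<in> A \<union> C" "\<psi> j \<in> B \<union> D" using \<phi> \<psi> by (auto simp: PiE_iff)
      ultimately show ?thesis using ZD(5) by simp
    qed
    then have "?c \<phi> \<psi> = ?k {i \<in> {..<n}. \<phi> i \<in> A} {j \<in> {..<m}. \<psi> j \<in> D}"
      by (intro arg_cong[of _ _ of_bool] ball_cong refl) auto
    then show "?wR \<psi> * ?c \<phi> \<psi> = ?k {i \<in> {..<n}. \<phi> i \<in> A} {j \<in> {..<m}. \<psi> j \<in> D} * ?wR \<psi>"
      by (simp only: mult.commute)
  qed
  \<comment> \<open>The right side is summed first, with the left set as a parameter; the result
    again depends on \<phi> only through that set, so the same lemma then applies on the
    left.\<close>
  also have "\<dots> = (\<Sum>\<phi> \<in> {..<n} \<rightarrow>\<^sub>E A \<union> C. (\<Sum>J \<in> Pow {..<m}. ?k {i \<in> {..<n}. \<phi> i \<in> A} J * ?sR J) * ?wL \<phi>)"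
  proof (rule sum.cong[OF refl])
    fix \<phi>
    have "(\<Sum>\<psi> \<in> {..<m} \<rightarrow>\<^sub>E D \<union> B. ?k {i \<in> {..<n}. \<phi> i \<in> A} {j \<in> {..<m}. \<psi> j \<in> D} * ?wR \<psi>)
        = (\<Sum>J \<in> Pow {..<m}. ?k {i \<in> {..<n}. \<phi> i \<in> A} J * ?sR J)"
      using sum_PiE_two_classes[of "{..<m}" D B "?k {i \<in> {..<n}. \<phi> i \<in> A}" wR] finZ ZD(4)
      by (simp add: Int_commute)
    then show "?wL \<phi> * (\<Sum>\<psi> \<in> {..<m} \<rightarrow>\<^sub>E D \<union> B.
        ?k {i \<in> {..<n}. \<phi> i \<in> A} {j \<in> {..<m}. \<psi> j \<in> D} * ?wR \<psi>)
        = (\<Sum>J \<in> Pow {..<m}. ?k {i \<in> {..<n}. \<phi> i \<in> A} J * ?sR J) * ?wL \<phi>"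
      by (simp only: mult.commute)
  qed
  also have "\<dots> = (\<Sum>I \<in> Pow {..<n}. (\<Sum>J \<in> Pow {..<m}. ?k I J * ?sR J) * ?sL I)"
    using sum_PiE_two_classes[of "{..<n}" A C "\<lambda>I. \<Sum>J \<in> Pow {..<m}. ?k I J * ?sR J" wL] finZ ZD(3)
    by simp
  also have "\<dots> = (\<Sum>I \<in> Pow {..<n}. \<Sum>J \<in> Pow {..<m}. ?k I J * (?sL I * ?sR J))"
    by (simp add: sum_distrib_left sum_distrib_right ac_simps)
  finally show ?thesis .
qed

text \<open>Right vertex \<open>j\<close> is stored as \<open>n + j\<close>. Splitting a vertex set
  at \<open>n\<close> therefore gives a pair \<open>(I, J)\<close>, and independence becomes a
  condition on the edge list.\<close>

lemma sum_independent_sets_instance_graph: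
  fixes \<alpha> \<beta> :: int
  assumes es: "set es \<subseteq> {0..<n} \<times> {0..<m}"
  defines "G \<equiv> instance_graph n m es"
  shows "(\<Sum>I \<in> independent_sets G. \<alpha> ^ card (I \<inter> lpart G) * \<beta> ^ card (I \<inter> rpart G)) =
    (\<Sum>I \<in> Pow {..<n}. \<Sum>J \<in> Pow {..<m}. of_bool (\<forall>(i, j) \<in> set es. \<not> (i \<in> I \<and> j \<in> J)) *
      (\<alpha> ^ card I * \<beta> ^ card J))"
proof -
  let ?k = "\<lambda>(I, J). \<forall>(i, j) \<in> set es. \<not> (i \<in> I \<and> j \<in> J)"
  let ?X = "{IJ \<in> Pow {..<n} \<times> Pow {..<m}. ?k IJ}"
  define join where "join = (\<lambda>(I, J). I \<union> (+) n ` J)"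
  have "(\<Sum>I \<in> Pow {..<n}. \<Sum>J \<in> Pow {..<m}. of_bool (?k (I, J)) * (\<alpha> ^ card I * \<beta> ^ card J))
      = (\<Sum>IJ \<in> Pow {..<n} \<times> Pow {..<m}. if ?k IJ then \<alpha> ^ card (fst IJ) * \<beta> ^ card (snd IJ) else 0)"
    unfolding sum.cartesian_product by (rule sum.cong) auto
  also have "\<dots> = (\<Sum>IJ \<in> ?X. \<alpha> ^ card (fst IJ) * \<beta> ^ card (snd IJ))"
    by (rule sum.inter_filter[symmetric]) simp
  also have "\<dots> = (\<Sum>I \<in> independent_sets G. \<alpha> ^ card (I \<inter> lpart G) * \<beta> ^ card (I \<inter> rpart G))"
  proof (rule sum.reindex_bij_witness[of _ "\<lambda>S. (S \<inter> {..<n}, {j. j < m \<and> n + j \<in> S})" join])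
    fix IJ assume IJ: "IJ \<in> ?X"
    obtain I J where [simp]: "IJ = (I, J)" by (cases IJ)
    have IJ': "I \<subseteq> {..<n}" "J \<subseteq> {..<m}" "\<forall>(i, j) \<in> set es. \<not> (i \<in> I \<and> j \<in> J)" using IJ by auto
    have l: "join IJ \<inter> lpart G = I" using IJ' by (auto simp: join_def G_def instance_graph_def)
    have r: "join IJ \<inter> rpart G = (+) n ` J" using IJ' by (auto simp: join_def G_def instance_graph_def)
    show "(join IJ \<inter> {..<n}, {j. j < m \<and> n + j \<in> join IJ}) = IJ"
      using IJ' by (auto simp: join_def)
    show "join IJ \<in> independent_sets G"
      unfolding independent_sets_def
    proof (intro CollectI conjI ballI)
      show "join IJ \<subseteq> verts G" using IJ' by (auto simp: join_def G_def instance_graph_def verts_def)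
      fix e assume "e \<in> edges G"
      then obtain i j where ij: "(i, j) \<in> set es" "e = (i, n + j)" by (auto simp: G_def instance_graph_def)
      have "i < n" "j < m" using ij es by auto
      then show "case e of (u, v) \<Rightarrow> \<not> (u \<in> join IJ \<and> v \<in> join IJ)"
        using ij IJ' by (auto simp: join_def)
    qed
    show "\<alpha> ^ card (join IJ \<inter> lpart G) * \<beta> ^ card (join IJ \<inter> rpart G)
        = \<alpha> ^ card (fst IJ) * \<beta> ^ card (snd IJ)"
      unfolding l r by (simp add: card_image)
  next
    fix S assume S: "S \<in> independent_sets G"
    then have sub: "S \<subseteq> {0..<n + m}" by (auto simp: independent_sets_def verts_def G_def instance_graph_def)
    show "join (S \<inter> {..<n}, {j. j < m \<and> n + j \<in> S}) = S"
    proof (intro equalityI subsetI)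
      fix v assume v: "v \<in> S"
      show "v \<in> join (S \<inter> {..<n}, {j. j < m \<and> n + j \<in> S})"
      proof (cases "v < n")
        case False
        then have "v = n + (v - n)" "v - n < m" using v sub by auto
        then show ?thesis using v by (auto simp: join_def image_iff intro!: exI[of _ "v - n"])
      qed (use v in \<open>auto simp: join_def\<close>)
    qed (auto simp: join_def)
    have "\<not> (i \<in> S \<and> n + j \<in> S)" if "(i, j) \<in> set es" for i j
      using S that by (force simp: independent_sets_def G_def instance_graph_def)
    then show "(S \<inter> {..<n}, {j. j < m \<and> n + j \<in> S}) \<in> ?X"
      by auto
  qed
  finally show ?thesis by simp
qed

text \<open>Of the \<open>n\<close> factors \<open>c\<close>, the inverse of \<alpha>2, exactly
  \<open>n - k\<close> cancel the powers of \<alpha>2 and the other \<open>k\<close> turn \<alpha>1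
  into the ratio. Hence the total correction \<open>c ^ n\<close> is the same for every independent
  set.\<close>

lemma cong_power_rescale:
  fixes a1 a2 \<alpha>1 \<alpha>2 c q :: int
  assumes a: "[a1 = \<alpha>1] (mod q)" "[a2 = \<alpha>2] (mod q)" and c: "[\<alpha>2 * c = 1] (mod q)" and k: "k \<le> n"
  shows "[a1 ^ k * a2 ^ (n - k) * c ^ n = (\<alpha>1 * c mod q) ^ k] (mod q)"
proof -
  have "c ^ n = c ^ k * c ^ (n - k)" using k by (simp add: power_add[symmetric])
  then have "a1 ^ k * a2 ^ (n - k) * c ^ n = (a1 * c) ^ k * (a2 * c) ^ (n - k)"
    by (simp add: power_mult_distrib ac_simps)
  also have "[\<dots> = (\<alpha>1 * c mod q) ^ k * 1 ^ (n - k)] (mod q)"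
  proof (intro cong_mult cong_pow)
    show "[a1 * c = \<alpha>1 * c mod q] (mod q)"
      using cong_mult[OF a(1) cong_refl[of c]] by (simp add: Cong.cong_def)
    show "[a2 * c = 1] (mod q)"
      using cong_trans[OF cong_mult[OF a(2) cong_refl[of c]] c] .
  qed
  finally show ?thesis by simp
qed

lemma hom_set_nonzeroD:
  assumes "hom_set K x H S \<noteq> 0"
  obtains f where "f \<in> homs K H" "f x \<in> S"
proof -
  obtain v where "v \<in> S" "hom_at K x H v \<noteq> 0"
    using assms unfolding hom_set_def by (meson sum.neutral)
  then have "{f \<in> homs K H. f x = v} \<noteq> {}" unfolding hom_at_def by (metis card.empty)
  then show thesis using that \<open>v \<in> S\<close> by auto
qed

theorem theorem6p5:
  fixes p :: nat and H :: "'v bigraph" and A B C D :: "'v set" and \<alpha>1 \<alpha>2 \<beta>1 \<beta>2 :: int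
  assumes "prime p"
    and "bigraph H"
    and "rigid p H"
    and "\<not> complete_bipartite H"
    and "induced_thick_Z H A B C D"
    and "nondegenerate p H A B C D \<alpha>1 \<alpha>2 \<beta>1 \<beta>2"
  shows "poly_time_reducible
           (BIS_mod p ((\<alpha>1 * modular_inverse (int p) \<alpha>2) mod int p)
                      ((\<beta>1 * modular_inverse (int p) \<beta>2) mod int p))
           (CSP_mod p H)"
proof -
  note H = \<open>bigraph H\<close> and Z = \<open>induced_thick_Z H A B C D\<close>
  have p: "0 < p" using \<open>prime p\<close> by (simp add: prime_gt_0_nat)
  obtain KL :: "nat bigraph" and x and KR :: "nat bigraph" and y
    where K: "bigraph KL" "bigraph KR" and xy: "x \<in> verts KL" "y \<in> verts KR"
      and \<alpha>1: "[int (hom_set KL x H A) = \<alpha>1] (mod int p)" "\<not> [\<alpha>1 = 0] (mod int p)"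
      and \<alpha>2: "[int (hom_set KL x H C) = \<alpha>2] (mod int p)" "\<not> [\<alpha>2 = 0] (mod int p)"
      and \<beta>1: "[int (hom_set KR y H D) = \<beta>1] (mod int p)" "\<not> [\<beta>1 = 0] (mod int p)"
      and \<beta>2: "[int (hom_set KR y H B) = \<beta>2] (mod int p)" "\<not> [\<beta>2 = 0] (mod int p)"
      and L0: "\<forall>v \<in> lpart H - (A \<union> C). [hom_at KL x H v = 0] (mod p)"
      and R0: "\<forall>v \<in> rpart H - (B \<union> D). [hom_at KR y H v = 0] (mod p)"
    using \<open>nondegenerate p H A B C D \<alpha>1 \<alpha>2 \<beta>1 \<beta>2\<close> unfolding nondegenerate_def by blast
  note ZD = induced_thick_ZD[OF H Z]
  have HLR: "lpart H \<inter> rpart H = {}" using H by (simp add: bigraph_def)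
  \<comment> \<open>As \<alpha>1 is nonzero, some homomorphism sends \<open>x\<close> into
    \<open>A\<close>, which lies on the left; homomorphisms preserve sides.\<close>
  have x: "x \<in> lpart KL"
  proof (rule ccontr)
    assume "x \<notin> lpart KL"
    then have "x \<in> rpart KL" using xy by (simp add: verts_def)
    have "hom_set KL x H A \<noteq> 0" using \<alpha>1 by (metis cong_sym of_nat_0)
    then obtain f where "f \<in> homs KL H" "f x \<in> A" by (rule hom_set_nonzeroD)
    then have "f x \<in> rpart H" "f x \<in> lpart H"
      using \<open>x \<in> rpart KL\<close> ZD(1) by (auto simp: homs_def)
    then show False using HLR by auto
  qed
  have y: "y \<in> rpart KR"
  proof (rule ccontr)
    assume "y \<notin> rpart KR"
    then have "y \<in> lpart KR" using xy by (simp add: verts_def)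
    have "hom_set KR y H D \<noteq> 0" using \<beta>1 by (metis cong_sym of_nat_0)
    then obtain f where "f \<in> homs KR H" "f y \<in> D" by (rule hom_set_nonzeroD)
    then have "f y \<in> lpart H" "f y \<in> rpart H"
      using \<open>y \<in> lpart KR\<close> ZD(2) by (auto simp: homs_def)
    then show False using HLR by auto
  qed
  have L0': "[int (hom_at KL x H v) = 0] (mod int p)" if "v \<in> lpart H - (A \<union> C)" for v
    using L0 that cong_int_iff[of "hom_at KL x H v" 0 p] by simp
  have R0': "[int (hom_at KR y H v) = 0] (mod int p)" if "v \<in> rpart H - (B \<union> D)" for v
    using R0 that cong_int_iff[of "hom_at KR y H v" 0 p] by simp
  have fin: "finite (lpart KL)" "finite (rpart KL)" "finite (lpart KR)" "finite (rpart KR)"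
    "finite (edges KL)" "finite (edges KR)"
    using K finite_subset[of "edges KL" "lpart KL \<times> rpart KL"]
      finite_subset[of "edges KR" "lpart KR \<times> rpart KR"]
    by (simp_all add: bigraph_def)
  obtain pL where pL: "bij_betw pL (lpart KL) {..<card (lpart KL)}" "pL x = 0"
    using ex_numbering_from[OF fin(1) x] .
  obtain qR where qR: "bij_betw qR (rpart KR) {..<card (rpart KR)}" "qR y = 0"
    using ex_numbering_from[OF fin(4) y] .
  obtain qL where qL: "bij_betw qL (rpart KL) {..<card (rpart KL)}"
    using ex_bij_betw_finite_nat[OF fin(2)] by (auto simp: atLeast0LessThan)
  obtain pR where pR: "bij_betw pR (lpart KR) {..<card (lpart KR)}"
    using ex_bij_betw_finite_nat[OF fin(3)] by (auto simp: atLeast0LessThan)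
  obtain EL where EL: "set EL = map_prod pL qL ` edges KL"
    using finite_list[of "map_prod pL qL ` edges KL"] fin(5) by auto
  obtain ER where ER: "set ER = map_prod pR qR ` edges KR"
    using finite_list[of "map_prod pR qR ` edges KR"] fin(6) by auto
  note query = card_homs_query_graph[OF K x y _ pL qL pR qR EL ER]
  define c where "c = modular_inverse (int p) \<alpha>2"
  define d where "d = modular_inverse (int p) \<beta>2"
  have coprime: "coprime a (int p)" if "\<not> [a = 0] (mod int p)" for a
    using \<open>prime p\<close> that prime_imp_coprime[of "int p" a] by (simp add: cong_0_iff coprime_commute)
  \<comment> \<open>Nonnegativity matters because the machine multiplies natural numbers and is
    given \<open>nat c\<close> and \<open>nat d\<close>.\<close>
  have c: "[\<alpha>2 * c = 1] (mod int p)" "0 \<le> c" and d: "[\<beta>2 * d = 1] (mod int p)" "0 \<le> d"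
    using p coprime[OF \<alpha>2(2)] coprime[OF \<beta>2(2)]
    by (simp_all add: c_def d_def cong_modular_inverse1 modular_inverse_int_nonneg)
  define \<alpha> where "\<alpha> = \<alpha>1 * c mod int p"
  define \<beta> where "\<beta> = \<beta>1 * d mod int p"
  have "poly_time_reducible (BIS_mod p \<alpha> \<beta>) (CSP_mod p H)"
    unfolding BIS_mod_def CSP_mod_def
  proof (rule graph_problem_reduction[where c = "nat c" and d = "nat d", OF p query(1)])
    fix n m and es :: "(nat \<times> nat) list" assume es: "set es \<subseteq> {0..<n} \<times> {0..<m}"
    then have E: "set es \<subseteq> {..<n} \<times> {..<m}" by auto
    let ?G = "instance_graph n m es"
    let ?k = "\<lambda>I J. of_bool (\<forall>(i, j) \<in> set es. \<not> (i \<in> I \<and> j \<in> J)) :: int"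
    let ?wL = "\<lambda>v. int (hom_at KL x H v)" and ?wR = "\<lambda>v. int (hom_at KR y H v)"
    define N where "N = card (homs (instance_graph (card (lpart KL) * n + card (lpart KR) * m)
      (card (rpart KR) * m + card (rpart KL) * n)
      (query_edges (card (lpart KL)) (card (rpart KR)) EL ER n m es)) H)"
    define X where "X = (\<Sum>I \<in> independent_sets ?G. \<alpha> ^ card (I \<inter> lpart ?G) * \<beta> ^ card (I \<inter> rpart ?G))"
    define S where "S = (\<Sum>I \<in> Pow {..<n}. \<Sum>J \<in> Pow {..<m}. ?k I J *
        ((sum ?wL A ^ card I * sum ?wL C ^ (n - card I)) *
         (sum ?wR D ^ card J * sum ?wR B ^ (m - card J))))"
    have int_N: "int N = (\<Sum>\<phi> \<in> {..<n} \<rightarrow>\<^sub>E lpart H. \<Sum>\<psi> \<in> {..<m} \<rightarrow>\<^sub>E rpart H.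
        of_bool (\<forall>(i, j) \<in> set es. (\<phi> i, \<psi> j) \<in> edges H) * ((\<Prod>i<n. ?wL (\<phi> i)) * (\<Prod>j<m. ?wR (\<psi> j))))"
      unfolding N_def query(2)[OF es] card_homs_glued[OF K x y E] card_glued_pairs[OF K H x y E]
      by simp
    have N: "[int N = S] (mod int p)"
      unfolding int_N S_def by (rule weighted_homs_cong_independent_sets[OF H Z E L0' R0'])
    have S: "[S * (c ^ n * d ^ m) = X] (mod int p)"
    proof -
      have "S * (c ^ n * d ^ m) = (\<Sum>I \<in> Pow {..<n}. \<Sum>J \<in> Pow {..<m}. ?k I J *
          ((sum ?wL A ^ card I * sum ?wL C ^ (n - card I) * c ^ n) *
           (sum ?wR D ^ card J * sum ?wR B ^ (m - card J) * d ^ m)))" (is "_ = ?Y")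
        unfolding S_def sum_distrib_right by (intro sum.cong refl) (simp only: ac_simps)
      moreover have "[?Y = X] (mod int p)"
        unfolding X_def sum_independent_sets_instance_graph[OF es]
      proof (intro cong_sum cong_mult cong_refl)
        fix I J assume IJ: "I \<in> Pow {..<n}" "J \<in> Pow {..<m}"
        have "card I \<le> n" "card J \<le> m"
          using IJ card_mono[of "{..<n}" I] card_mono[of "{..<m}" J] by auto
        then show "[sum ?wL A ^ card I * sum ?wL C ^ (n - card I) * c ^ n = \<alpha> ^ card I] (mod int p)"
          "[sum ?wR D ^ card J * sum ?wR B ^ (m - card J) * d ^ m = \<beta> ^ card J] (mod int p)"
          unfolding \<alpha>_def \<beta>_def using \<alpha>1(1) \<alpha>2(1) \<beta>1(1) \<beta>2(1) c(1) d(1)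
          by (auto intro!: cong_power_rescale simp: hom_set_def)
      qed
      ultimately show ?thesis by (simp only:)
    qed
    have X: "X mod int p = int N * (c ^ n * d ^ m) mod int p"
      using cong_trans[OF cong_mult[OF N cong_refl] S] by (simp add: Cong.cong_def)
    \<comment> \<open>The oracle reveals only \<open>N mod p\<close>, which is enough since
      everything else is computed modulo \<open>p\<close>.\<close>
    have "int ((N mod p) * nat c ^ n * nat d ^ m mod p) = int N * (c ^ n * d ^ m) mod int p"
      using c(2) d(2) by (simp add: zmod_int mod_simps mult.assoc)
    then show "nat (X mod int p) = (N mod p) * nat c ^ n * nat d ^ m mod p"
      unfolding X by linarith
  qed (use p in simp_all)
  then show ?thesis by (simp add: \<alpha>_def \<beta>_def c_def d_def)
qed

end
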